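(* For every $u\in[0,a]$, $$\mathbb P_u(\widehat\tau_0^-<\widehat\tau_a^+)=\mathbb E\,\mathbb P_{u+U}(\tau_0^-<\widetilde\tau_a^+)=\mathbb E\,\mathbb P_{u+D}(\widetilde\tau_0^-<\tau_a^+),$$ and conversely $$\mathbb P_u(\tau_0^-<\widetilde\tau_a^+)=\mathbb E\,\mathbb P_{u+D}(\widehat\tau_0^-<\widehat\tau_a^+),\qquad \mathbb P_u(\widetilde\tau_0^-<\tau_a^+)=\mathbb E\,\mathbb P_{u+U}(\widehat\tau_0^-<\widehat\tau_a^+).$$
   Context: $X=(X_t)_{t\ge 0}$ is a real-valued (càdlàg) Lévy process; $\mathbb P_v$, $\mathbb E_v$ denote probability and expectation when $X$ is started at $v$, and $\mathbb P=\mathbb P_0$, $\mathbb E=\mathbb E_0$. $0<T_1<T_2<\dots$ are the epochs of a homogeneous Poisson process of fixed intensity $\lambda>0$ independent of $X$, and $T_0=0$. $\mathbb N=\{1,2,\dots\}$, $\mathbb N_0=\{0,1,2,\dots\}$; the infimum or minimum of an empty set is $\infty$, and $T_\infty=\infty$. First passage times under continuous observation: $\tau_0^-=\inf\{t\ge 0: X_t<0\}$, $\tau_a^+=\inf\{t\ge 0:X_t>a\}$. Under Poisson observation: $\widehat\tau_0^-=\min\{T_i, i\in\mathbb N_0: X_{T_i}<0\}$, $\widehat\tau_a^+=\min\{T_i,i\in\mathbb N_0:X_{T_i}>a\}$. $\widetilde\tau_a^+=T_{\widetilde N_a^+}$ with $\widetilde N_a^+=\min\{i\in\mathbb N:\inf\{X_t:t\in[T_{i-1},T_i]\}>a\}$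 is the first observation time such that $X$ has stayed above $a$ during the entire preceding inter-observation period; $\widetilde\tau_0^-=T_{\widetilde N_0^-}$ with $\widetilde N_0^-=\min\{i\in\mathbb N:\sup\{X_t:t\in[T_{i-1},T_i]\}<0\}$ is the first observation time such that $X$ has stayed below $0$ during the entire preceding inter-observation period. $\underline X_t=\inf\{X_s:s\in[0,t]\}$ and $\overline X_t=\sup\{X_s:s\in[0,t]\}$. $D$ and $U$ are random variables, independent of each other and of everything else, where $D$ has the law of $\underline X_{T_1}$ under $\mathbb P$ and $U$ has the law of $\overline X_{T_1}$ under $\mathbb P$. $\mathbb E\,\mathbb P_{u+U}(\cdot)$ means the expectation over $U$ of the function $v\mapsto\mathbb P_v(\cdot)$ evaluated at $v=u+U$ (similarly for $D$). *)

theory Defs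
  imports "HOL-Probability.Probability"
begin

definition cadlag :: "(real \<Rightarrow> real) \<Rightarrow> bool" where
  "cadlag x \<longleftrightarrow>
     (\<forall>t\<ge>0. continuous (at_right t) x) \<and>
     (\<forall>t>0. \<exists>l. (x \<longlongrightarrow> l) (at_left t))"

text \<open>
  A Levy process under the measure that starts it at 0. Only times \<open>t \<ge> 0\<close> matter: the values
  of \<open>X\<close> at negative times are unconstrained and never used.
\<close>

definition levy_process :: "'w measure \<Rightarrow> (real \<Rightarrow> 'w \<Rightarrow> real) \<Rightarrow> bool" where
  "levy_process M X \<longleftrightarrow>
     prob_space M \<and>
     (\<forall>t\<ge>0. X t \<in> borel_measurable M) \<and>
     (AE \<omega> in M. X 0 \<omega> = 0) \<and>
     (\<forall>n (t :: nat \<Rightarrow> real). 0 \<le> t 0 \<longrightarrow> mono_on {..n} t \<longrightarrow>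
        prob_space.indep_vars M (\<lambda>_. borel) (\<lambda>i \<omega>. X (t (Suc i)) \<omega> - X (t i) \<omega>) {..<n}) \<and>
     (\<forall>s\<ge>0. \<forall>h\<ge>0. distr M borel (\<lambda>\<omega>. X (s + h) \<omega> - X s \<omega>) = distr M borel (X h)) \<and>
     (\<forall>\<omega>\<in>space M. cadlag (\<lambda>t. X t \<omega>))"

text \<open>
  Epochs of a homogeneous Poisson process with intensity \<open>lam\<close>, as partial sums of
  independent exponential waiting times; \<open>T 0 = 0\<close> is the convention for index 0.
\<close>

definition poisson_epochs :: "'w measure \<Rightarrow> real \<Rightarrow> (nat \<Rightarrow> 'w \<Rightarrow> real) \<Rightarrow> bool" where
  "poisson_epochs M lam T \<longleftrightarrow>
     (\<forall>\<omega>\<in>space M. T 0 \<omega> = 0 \<and> strict_mono (\<lambda>i. T i \<omega>)) \<and>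
     (\<forall>i. distributed M lborel (\<lambda>\<omega>. T (Suc i) \<omega> - T i \<omega>) (exponential_density lam)) \<and>
     prob_space.indep_vars M (\<lambda>_. borel) (\<lambda>i \<omega>. T (Suc i) \<omega> - T i \<omega>) UNIV"

text \<open>
  Independence of two random elements whose value types may differ; the library's \<open>indep_var\<close>
  requires both to have the same value type.
\<close>

definition indep_elements ::
  "'w measure \<Rightarrow> 'b measure \<Rightarrow> ('w \<Rightarrow> 'b) \<Rightarrow> 'c measure \<Rightarrow> ('w \<Rightarrow> 'c) \<Rightarrow> bool" where
  "indep_elements M S Y S' Z \<longleftrightarrow>
     Y \<in> measurable M S \<and> Z \<in> measurable M S' \<and>
     prob_space.indep_set M {Y -` A \<inter> space M | A. A \<in> sets S} {Z -` A \<inter> space M | A. A \<in> sets S'}"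

definition path_of :: "(real \<Rightarrow> 'w \<Rightarrow> real) \<Rightarrow> 'w \<Rightarrow> real \<Rightarrow> real" where
  "path_of X \<omega> = (\<lambda>t\<in>{0..}. X t \<omega>)"

abbreviation path_space :: "(real \<Rightarrow> real) measure" where
  "path_space \<equiv> (\<Pi>\<^sub>M t\<in>{0..}. borel)"

abbreviation epoch_space :: "(nat \<Rightarrow> real) measure" where
  "epoch_space \<equiv> (\<Pi>\<^sub>M i\<in>UNIV. borel)"

text \<open>
  The infima and suprema over compact time intervals below are conditionally complete ones on the
  reals; they are genuine because cadlag paths are bounded on compact intervals.
\<close>

definition running_inf :: "(real \<Rightarrow> real) \<Rightarrow> real \<Rightarrow> real" where
  "running_inf x t = (INF s\<in>{0..t}. x s)"

definition running_sup :: "(real \<Rightarrow> real) \<Rightarrow> real \<Rightarrow> real" where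
  "running_sup x t = (SUP s\<in>{0..t}. x s)"

text \<open>
  Passage times of a path \<open>x\<close>, observed at epochs \<open>T\<close> where relevant. They are
  extended reals, so an infimum over the empty set is \<open>\<infinity>\<close>. As \<open>T\<close> is strictly
  increasing, the infima over observation epochs are minima when the set is nonempty.
\<close>

definition tau_below :: "real \<Rightarrow> (real \<Rightarrow> real) \<Rightarrow> ereal" where
  "tau_below b x = Inf {ereal t | t. 0 \<le> t \<and> x t < b}"

definition tau_above :: "real \<Rightarrow> (real \<Rightarrow> real) \<Rightarrow> ereal" where
  "tau_above a x = Inf {ereal t | t. 0 \<le> t \<and> x t > a}"

definition tau_hat_below :: "real \<Rightarrow> (nat \<Rightarrow> real) \<Rightarrow> (real \<Rightarrow> real) \<Rightarrow> ereal" where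
  "tau_hat_below b T x = Inf {ereal (T i) | i. x (T i) < b}"

definition tau_hat_above :: "real \<Rightarrow> (nat \<Rightarrow> real) \<Rightarrow> (real \<Rightarrow> real) \<Rightarrow> ereal" where
  "tau_hat_above a T x = Inf {ereal (T i) | i. x (T i) > a}"

definition epoch_at :: "(nat \<Rightarrow> real) \<Rightarrow> enat \<Rightarrow> ereal" where
  "epoch_at T N = (case N of enat n \<Rightarrow> ereal (T n) | \<infinity> \<Rightarrow> \<infinity>)"

definition N_tilde_below :: "real \<Rightarrow> (nat \<Rightarrow> real) \<Rightarrow> (real \<Rightarrow> real) \<Rightarrow> enat" where
  "N_tilde_below b T x = Inf {enat i | i. 1 \<le> i \<and> (SUP t\<in>{T (i - 1)..T i}. x t) < b}"

definition N_tilde_above :: "real \<Rightarrow> (nat \<Rightarrow> real) \<Rightarrow> (real \<Rightarrow> real) \<Rightarrow> enat" where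
  "N_tilde_above a T x = Inf {enat i | i. 1 \<le> i \<and> (INF t\<in>{T (i - 1)..T i}. x t) > a}"

definition tau_tilde_below :: "real \<Rightarrow> (nat \<Rightarrow> real) \<Rightarrow> (real \<Rightarrow> real) \<Rightarrow> ereal" where
  "tau_tilde_below b T x = epoch_at T (N_tilde_below b T x)"

definition tau_tilde_above :: "real \<Rightarrow> (nat \<Rightarrow> real) \<Rightarrow> (real \<Rightarrow> real) \<Rightarrow> ereal" where
  "tau_tilde_above a T x = epoch_at T (N_tilde_above a T x)"

text \<open>
  The probability that the pair (epochs, path) satisfies \<open>A\<close> when the Levy process is started
  at \<open>v\<close>: the law of the process started at \<open>v\<close> is that of \<open>v + X\<close>.
\<close>

definition prob_from ::
  "'w measure \<Rightarrow> (real \<Rightarrow> 'w \<Rightarrow> real) \<Rightarrow> (nat \<Rightarrow> 'w \<Rightarrow> real) \<Rightarrow> real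
     \<Rightarrow> ((nat \<Rightarrow> real) \<Rightarrow> (real \<Rightarrow> real) \<Rightarrow> bool) \<Rightarrow> real" where
  "prob_from M X T v A = measure M {\<omega> \<in> space M. A (\<lambda>i. T i \<omega>) (\<lambda>t. v + X t \<omega>)}"

end

theory Submission
  imports Defs
begin

text \<open>
  Why the identities hold. Cut the path at the epochs and call the restriction to
  \<open>[T i, T (i + 1)]\<close> block \<open>i\<close>. Every event of the theorem compares two indices of one sequence: the
  sequence has a negative entry before any entry above \<open>a\<close> (\<open>falls_first\<close>). For the Poissonian
  times this is the sequence of values \<open>X (T i)\<close>, for \<open>tau_below 0 < tau_tilde_above a\<close> it is the
  sequence of block infima (\<open>tau_below_less_tilde_above_iff\<close>), and for
  \<open>tau_tilde_below 0 < tau_above a\<close> the sequence of block suprema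
  (\<open>tau_tilde_below_less_above_iff\<close>).

  By the Wiener-Hopf factorization at an exponential time, the drop from the start of a block to its
  infimum and the rise from the infimum to the end of the block are independent, with the laws of
  \<open>D\<close> and \<open>U\<close>; distinct blocks are independent. Hence
  \<open>X (T 0)\<close>, infimum of block 0, \<open>X (T 1)\<close>, infimum of block 1, \<open>\<dots>\<close>
  is a walk whose independent steps have alternately the laws of \<open>D\<close> and \<open>U\<close>
  (\<open>distr_low_steps\<close>). With suprema in place of infima the steps have alternately the laws of
  \<open>U\<close> and \<open>D\<close> (\<open>distr_high_steps\<close>). The Poissonian observations are the even times of either
  walk, the block infima the odd times of the first, the block suprema the odd times of the second.
  Deleting the first step of one walk leaves the other walk with a randomly shifted start
  (\<open>alt_falls_Suc\<close>). Started at \<open>u + D\<close>, the second walk observed at even times is thus the first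
  walk from \<open>u\<close> observed at odd times: this is the third identity, and the fourth is its mirror image.
  For the first identity, observe the second walk from \<open>u\<close> at even times. Time 0 is
  irrelevant because \<open>u\<close> lies in \<open>[0, a]\<close> (\<open>alt_falls_0_eq_2\<close>), and deleting the first step turns
  the times 2, 4, \<open>\<dots>\<close> into the odd times of the first walk from \<open>u + U\<close>. The second identity is
  again the mirror image.

  The factorization itself is proved on grids. On a grid of mesh \<open>h\<close> the path is a random walk and
  the exponential waiting times, rounded up, become geometric; there the factorization is the
  decomposition at the first minimum together with time reversal (\<open>Wiener_Hopf_geometric\<close>).
  Rounding up lets right continuity yield the convergence of all grid quantities, for every outcome,
  as \<open>h\<close> tends to 0 (\<open>grid_min_tendsto\<close>), so the product formula for bounded continuous test
  functions survives in the limit (\<open>block_factorization\<close>) and determines the joint law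
  (\<open>distr_eq_PiM_continuous\<close>).
\<close>

section \<open>Cadlag paths and their extrema on grids\<close>

text \<open>
  Only one-sided limits are available, so compactness enters through the Bolzano principle: near
  every point a cadlag path stays close to its value on the right and close to its left limit on the
  left. At time 0 there is no left neighbourhood to control.
\<close>

lemma cadlag_bounded_on:
  assumes "cadlag x" "0 \<le> s"
  shows "bounded (x ` {s..t})"
proof (cases "s \<le> t")
  case True
  have "s \<le> t \<Longrightarrow> 0 \<le> s \<longrightarrow> bounded (x ` {s..t})"
  proof (induction rule: Bolzano)
    case (trans a b c)
    show ?case
    proof
      assume "0 \<le> a"
      moreover have "{a..c} = {a..b} \<union> {b..c}" using trans by auto
      ultimately show "bounded (x ` {a..c})"
        using trans by (auto simp: image_Un)
    qed
  next
    case (local r)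
    have r0: "0 \<le> r" using local assms by linarith
    have "(x \<longlongrightarrow> x r) (at_right r)"
      using assms r0 by (auto simp: cadlag_def continuous_within)
    then have "\<forall>\<^sub>F y in at_right r. dist (x y) (x r) < 1"
      by (rule tendstoD) simp
    then obtain b where b: "r < b" "\<And>y. r < y \<Longrightarrow> y < b \<Longrightarrow> dist (x y) (x r) < 1"
      by (auto simp: eventually_at_right_field)
    obtain l c where c: "c < r" "\<And>y. c < y \<Longrightarrow> y < r \<Longrightarrow> 0 \<le> y \<Longrightarrow> dist (x y) l < 1"
    proof (cases "r = 0")
      case True
      show ?thesis by (rule that[of "-1" 0]) (use True in auto)
    next
      case False
      then obtain l where "(x \<longlongrightarrow> l) (at_left r)"
        using assms r0 unfolding cadlag_def by (metis order_le_less)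
      then have "\<forall>\<^sub>F y in at_left r. dist (x y) l < 1"
        by (rule tendstoD) simp
      then obtain c where "c < r" "\<And>y. c < y \<Longrightarrow> y < r \<Longrightarrow> dist (x y) l < 1"
        by (auto simp: eventually_at_left_field)
      then show ?thesis by (intro that[of c l]) auto
    qed
    have near: "x y \<in> cball (x r) 1 \<union> cball l 1" if "c < y" "y < b" "0 \<le> y" for y
      using b(2)[of y] c(2)[of y] that
      by (cases y r rule: linorder_cases) (auto simp: dist_commute less_imp_le)
    show ?case
    proof (intro exI[of _ "min (b - r) (r - c)"] conjI allI impI)
      show "0 < min (b - r) (r - c)" using b c by auto
      fix a' b' assume *: "a' \<le> r \<and> r \<le> b' \<and> b' - a' < min (b - r) (r - c)" and "0 \<le> a'"
      then have "x ` {a'..b'} \<subseteq> cball (x r) 1 \<union> cball l 1"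
        using * by (intro image_subsetI near) (auto simp: min_def split: if_splits)
      then show "bounded (x ` {a'..b'})"
        by (rule bounded_subset[rotated]) simp
    qed
  qed
  then show ?thesis using assms(2) True by blast
qed simp

lemma cadlag_const_add: "cadlag x \<Longrightarrow> cadlag (\<lambda>t. v + x t)"
  unfolding cadlag_def
  by (auto intro!: continuous_intros) (use tendsto_add[OF tendsto_const] in fast)

lemma cadlag_uminus: "cadlag x \<Longrightarrow> cadlag (\<lambda>t. - x t)"
  unfolding cadlag_def
  by (auto intro!: continuous_intros) (use tendsto_minus in fast)

lemma cadlag_right_tendsto:
  assumes "cadlag x" "0 \<le> t" "p \<longlonglongrightarrow> t" "\<And>n. t \<le> p n"
  shows "(\<lambda>n. x (p n)) \<longlonglongrightarrow> x t"
proof -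
  have "continuous (at t within {t..}) x"
    using assms(1,2)
    by (auto simp: cadlag_def continuous_within at_within_Ici_at_right)
  then show ?thesis
    using assms(3,4) by (auto simp: continuous_within_sequentially o_def)
qed

text \<open>
  A cadlag path is only continuous from the right, so a point \<open>t\<close> has to be approached by grid
  points that are at least \<open>t\<close>. Such points exist up to and including the right end because the
  grid is required to reach at least \<open>b\<close>.
\<close>

lemma grid_point_approx:
  fixes s e h :: "nat \<Rightarrow> real" and K :: "nat \<Rightarrow> nat" and a b t :: real
  assumes h: "h \<longlonglongrightarrow> 0" "\<And>n. 0 < h n"
    and s: "s \<longlonglongrightarrow> a" "\<And>n. a \<le> s n"
    and e: "\<And>n. b \<le> s n + h n * K n"
    and t: "a \<le> t" "t \<le> b"
  obtains k where "\<And>n. k n \<le> K n" "\<And>n. t \<le> s n + h n * k n" "(\<lambda>n. s n + h n * k n) \<longlonglongrightarrow> t"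
proof -
  \<comment> \<open>the grid starts at \<open>s n\<close>, possibly after \<open>t\<close>\<close>
  define m where "m n = max t (s n)" for n
  define k where "k n = nat \<lceil>(m n - s n) / h n\<rceil>" for n
  have m: "s n \<le> m n" "t \<le> m n" for n by (auto simp: m_def)
  have k_ge: "(m n - s n) / h n \<le> k n" for n
    unfolding k_def by (metis of_nat_ceiling)
  have k_le: "k n \<le> (m n - s n) / h n + 1" for n
  proof -
    have "0 \<le> (m n - s n) / h n" using m h(2)[of n] by simp
    then show ?thesis unfolding k_def by linarith
  qed
  have ge: "m n \<le> s n + h n * k n" for n
    using k_ge[of n] h(2)[of n] by (simp add: field_simps)
  have le: "s n + h n * k n \<le> m n + h n" for n
    using k_le[of n] h(2)[of n] by (simp add: field_simps)
  have m_le: "(m n - s n) / h n \<le> K n" for n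
    using e[of n] t h(2)[of n] by (auto simp: field_simps m_def max_def)
  have mt: "m \<longlonglongrightarrow> max t a" unfolding m_def by (intro tendsto_intros s)
  have mt: "m \<longlonglongrightarrow> t" using mt t by (simp add: max_absorb1)
  show ?thesis
  proof (rule that)
    show "k n \<le> K n" for n
      using m_le[of n] unfolding k_def by (simp add: nat_le_iff ceiling_le_iff)
    show "t \<le> s n + h n * k n" for n using ge[of n] m(2)[of n] by linarith
    have "(\<lambda>n. m n + h n) \<longlonglongrightarrow> t + 0" by (intro tendsto_intros mt h)
    then show "(\<lambda>n. s n + h n * k n) \<longlonglongrightarrow> t"
      using tendsto_sandwich[OF _ _ mt, of "\<lambda>n. s n + h n * k n" "\<lambda>n. m n + h n"] ge le by simp
  qed
qed

text \<open>
  Every value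
  \<open>x t\<close> is a limit of grid values, so the grid minimum is eventually not much above the infimum;
  the finitely many grid points beyond \<open>b\<close> can lower the minimum only by a vanishing amount, by
  right continuity at \<open>b\<close>. Rounding to the right is what makes the convergence hold for every path,
  so that no almost sure continuity at the epochs has to be invoked.
\<close>

lemma grid_min_tendsto:
  fixes s h :: "nat \<Rightarrow> real" and K :: "nat \<Rightarrow> nat" and a b :: real
  assumes x: "cadlag x" and a: "0 \<le> a" "a \<le> b"
    and h: "h \<longlonglongrightarrow> 0" "\<And>n. 0 < h n"
    and s: "s \<longlonglongrightarrow> a" "\<And>n. a \<le> s n"
    and e: "(\<lambda>n. s n + h n * K n) \<longlonglongrightarrow> b" "\<And>n. b \<le> s n + h n * K n"
  shows "(\<lambda>n. Min ((\<lambda>k. x (s n + h n * real k)) ` {..K n})) \<longlonglongrightarrow> (INF t\<in>{a..b}. x t)"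
    (is "?m \<longlonglongrightarrow> ?I")
proof (rule order_tendstoI)
  have bdd: "bdd_below (x ` {a..b})"
    using cadlag_bounded_on[OF x a(1)] by (rule bounded_imp_bdd_below)
  fix y assume y: "y < ?I"
  have "?I \<le> x b" using bdd a by (intro cINF_lower) auto
  have "(x \<longlongrightarrow> x b) (at_right b)"
    using x a by (auto simp: cadlag_def continuous_within)
  then have "\<forall>\<^sub>F t in at_right b. y < x t"
    using y \<open>?I \<le> x b\<close> by (intro order_tendstoD(1)[of x "x b"]) linarith+
  then obtain c where c: "b < c" "\<And>t. b < t \<Longrightarrow> t < c \<Longrightarrow> y < x t"
    by (auto simp: eventually_at_right_field)
  have "\<forall>\<^sub>F n in sequentially. s n + h n * K n < c"
    using e(1) c(1) by (rule order_tendstoD)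
  then show "\<forall>\<^sub>F n in sequentially. y < ?m n"
  proof eventually_elim
    case (elim n)
    have "y < x (s n + h n * k)" if "k \<le> K n" for k :: nat
    proof -
      have "h n * k \<le> h n * K n" "0 \<le> h n * k"
        using h(2)[of n] that by (simp_all add: mult_left_mono)
      then have p: "a \<le> s n + h n * k" "s n + h n * k < c"
        using s(2)[of n] elim by linarith+
      show ?thesis
      proof (cases "s n + h n * k \<le> b")
        case True
        then have "?I \<le> x (s n + h n * k)" using bdd p by (intro cINF_lower) auto
        then show ?thesis using y by linarith
      qed (use c p in auto)
    qed
    then show ?case by (subst Min_gr_iff) auto
  qed
next
  fix y assume "?I < y"
  then obtain t where t: "t \<in> {a..b}" "x t < y"
    using a cInf_lessD[of "x ` {a..b}" y] by auto
  obtain k where k: "\<And>n. k n \<le> K n" "\<And>n. t \<le> s n + h n * k n" "(\<lambda>n. s n + h n * k n) \<longlonglongrightarrow> t"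
    using grid_point_approx[OF h s e(2), of t] t by auto
  have "(\<lambda>n. x (s n + h n * k n)) \<longlonglongrightarrow> x t"
    by (rule cadlag_right_tendsto[OF x _ k(3) k(2)]) (use t a in auto)
  then have "\<forall>\<^sub>F n in sequentially. x (s n + h n * k n) < y"
    using t(2) by (rule order_tendstoD)
  then show "\<forall>\<^sub>F n in sequentially. ?m n < y"
  proof eventually_elim
    case (elim n)
    then show ?case using k(1)[of n] by (subst Min_less_iff) auto
  qed
qed

lemma grid_max_tendsto:
  fixes s h :: "nat \<Rightarrow> real" and K :: "nat \<Rightarrow> nat" and a b :: real
  assumes x: "cadlag x" and a: "0 \<le> a" "a \<le> b"
    and h: "h \<longlonglongrightarrow> 0" "\<And>n. 0 < h n"
    and s: "s \<longlonglongrightarrow> a" "\<And>n. a \<le> s n"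
    and e: "(\<lambda>n. s n + h n * K n) \<longlonglongrightarrow> b" "\<And>n. b \<le> s n + h n * K n"
  shows "(\<lambda>n. Max ((\<lambda>k. x (s n + h n * real k)) ` {..K n})) \<longlonglongrightarrow> (SUP t\<in>{a..b}. x t)"
proof -
  have min: "Min ((\<lambda>k. - x (s n + h n * real k)) ` {..K n}) = - Max ((\<lambda>k. x (s n + h n * real k)) ` {..K n})" for n
    by (subst minus_Max_eq_Min) (auto simp: image_image)
  have inf: "(INF t\<in>{a..b}. - x t) = - (SUP t\<in>{a..b}. x t)"
    by (simp add: Inf_real_def image_image)
  have "(\<lambda>n. - Max ((\<lambda>k. x (s n + h n * real k)) ` {..K n})) \<longlonglongrightarrow> - (SUP t\<in>{a..b}. x t)"
    using grid_min_tendsto[OF cadlag_uminus[OF x] a h s e] unfolding min inf .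
  then show ?thesis by (rule tendsto_minus_cancel)
qed

section \<open>Passage events in terms of sequences\<close>

text \<open>
  The common shape of all passage events of the theorem: a sequence goes below 0, and it has not
  exceeded \<open>a\<close> before. For \<open>a \<ge> 0\<close> both cannot happen at the same index.
\<close>

definition falls_first :: "real \<Rightarrow> (nat \<Rightarrow> real) \<Rightarrow> bool" where
  "falls_first a w \<longleftrightarrow> (\<exists>n. w n < 0 \<and> (\<forall>k<n. w k \<le> a))"

lemma epoch_block:
  fixes T :: "nat \<Rightarrow> real"
  assumes "T 0 = 0" "0 \<le> t" "t < T n"
  shows "\<exists>i<n. T i \<le> t \<and> t < T (Suc i)"
  using assms(3)
proof (induction n)
  case (Suc n)
  show ?case
  proof (cases "t < T n")
    case True
    then show ?thesis using Suc.IH less_SucI by blast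
  next
    case False
    then show ?thesis using Suc.prems by (intro exI[of _ n]) auto
  qed
qed (use assms in simp)

lemma epochs_nonneg:
  fixes T :: "nat \<Rightarrow> real"
  assumes "T 0 = 0" "strict_mono T"
  shows "0 \<le> T i"
  using assms by (metis strict_mono_leD zero_le)

lemma tau_hat_less_iff:
  assumes T: "strict_mono T" and a: "0 \<le> a"
  shows "tau_hat_below 0 T x < tau_hat_above a T x \<longleftrightarrow> falls_first a (\<lambda>i. x (T i))"
proof
  assume "tau_hat_below 0 T x < tau_hat_above a T x"
  then obtain i where i: "x (T i) < 0" "ereal (T i) < tau_hat_above a T x"
    unfolding tau_hat_below_def Inf_less_iff by auto
  have "x (T k) \<le> a" if "k < i" for k
  proof (rule ccontr)
    assume "\<not> x (T k) \<le> a"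
    then have "tau_hat_above a T x \<le> ereal (T k)"
      unfolding tau_hat_above_def by (intro Inf_lower) auto
    also have "\<dots> < ereal (T i)" using that T by (auto simp: strict_mono_def)
    finally show False using i by simp
  qed
  then show "falls_first a (\<lambda>i. x (T i))" using i by (auto simp: falls_first_def)
next
  assume "falls_first a (\<lambda>i. x (T i))"
  then obtain n where n: "x (T n) < 0" "\<And>k. k < n \<Longrightarrow> x (T k) \<le> a"
    by (auto simp: falls_first_def)
  have "tau_hat_below 0 T x \<le> ereal (T n)"
    unfolding tau_hat_below_def using n by (intro Inf_lower) auto
  also have "\<dots> < ereal (T (Suc n))" using T by (auto simp: strict_mono_def)
  also have "\<dots> \<le> tau_hat_above a T x"
    unfolding tau_hat_above_def
  proof (rule Inf_greatest, safe)
    fix i assume "a < x (T i)"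
    then have "i \<noteq> n" "\<not> i < n" using n a by (auto dest: n(2))
    then have "Suc n \<le> i" by simp
    then show "ereal (T (Suc n)) \<le> ereal (T i)" using T by (simp add: strict_mono_leD)
  qed
  finally show "tau_hat_below 0 T x < tau_hat_above a T x" .
qed

lemma Inf_enat_Suc_eq:
  "Inf {enat i | i. 1 \<le> i \<and> P (i - 1) i} =
     (if \<exists>j. P j (Suc j) then enat (Suc (LEAST j. P j (Suc j))) else \<infinity>)"
proof (cases "\<exists>j. P j (Suc j)")
  case True
  have "P (LEAST j. P j (Suc j)) (Suc (LEAST j. P j (Suc j)))" using True by (rule LeastI_ex)
  moreover have "(LEAST j. P j (Suc j)) \<le> i - 1" if "1 \<le> i" "P (i - 1) i" for i
    using that by (intro Least_le) auto
  ultimately have "Inf {enat i | i. 1 \<le> i \<and> P (i - 1) i} = enat (Suc (LEAST j. P j (Suc j)))"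
    by (intro antisym Inf_lower Inf_greatest) force+
  then show ?thesis using True by simp
next
  case False
  then have "\<not> P (i - 1) i" if "1 \<le> i" for i using that by (metis Suc_diff_1 less_eq_Suc_le One_nat_def)
  then have *: "{enat i | i. 1 \<le> i \<and> P (i - 1) i} = {}" by auto
  show ?thesis using False unfolding * by (simp add: top_enat_def)
qed

definition block_inf :: "(nat \<Rightarrow> real) \<Rightarrow> (real \<Rightarrow> real) \<Rightarrow> nat \<Rightarrow> real" where
  "block_inf t x i = (INF s\<in>{t i..t (Suc i)}. x s)"

definition block_sup :: "(nat \<Rightarrow> real) \<Rightarrow> (real \<Rightarrow> real) \<Rightarrow> nat \<Rightarrow> real" where
  "block_sup t x i = (SUP s\<in>{t i..t (Suc i)}. x s)"

text \<open>
  The path enters the negative half-line during block \<open>i\<close> exactly when the infimum of block \<open>i\<close> is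
  negative, and the block at which the whole preceding period was spent above \<open>a\<close> is the first one
  whose infimum exceeds \<open>a\<close>. Hence comparing the two times amounts to comparing two indices of the
  sequence of block infima. The second alternative covers a path that becomes negative only after
  all epochs have been exhausted; it has to be kept because the epochs tend to infinity only almost
  surely, whereas the identity of events is needed for every outcome to see that the event is
  measurable.
\<close>

lemma tau_below_less_tilde_above_iff:
  fixes x T a
  defines "m \<equiv> block_inf T x"
  assumes T: "T 0 = 0" "strict_mono T" and x: "cadlag x" and a: "0 \<le> a"
  shows "tau_below 0 x < tau_tilde_above a T x \<longleftrightarrow>
    falls_first a m \<or> (\<exists>t\<ge>0. x t < 0) \<and> (\<forall>i. m i \<le> a)"
proof -
  have N: "N_tilde_above a T x = (if \<exists>j. a < m j then enat (Suc (LEAST j. a < m j)) else \<infinity>)"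
    unfolding N_tilde_above_def m_def block_inf_def by (rule Inf_enat_Suc_eq)
  have bdd: "bdd_below (x ` {T i..T (Suc i)})" for i
    using cadlag_bounded_on[OF x epochs_nonneg[OF T]] by (rule bounded_imp_bdd_below)
  have ne: "{T i..T (Suc i)} \<noteq> {}" for i using T(2) by (auto simp: strict_mono_Suc_iff less_imp_le)
  show ?thesis
  proof
    assume "tau_below 0 x < tau_tilde_above a T x"
    then obtain t where t: "0 \<le> t" "x t < 0" "ereal t < tau_tilde_above a T x"
      unfolding tau_below_def Inf_less_iff by auto
    show "falls_first a m \<or> (\<exists>t\<ge>0. x t < 0) \<and> (\<forall>i. m i \<le> a)"
    proof (cases "\<exists>j. a < m j")
      case True
      define j where "j = (LEAST j. a < m j)"
      have "t < T (Suc j)" using t True N by (simp add: tau_tilde_above_def epoch_at_def j_def)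
      then obtain n where n: "n < Suc j" "T n \<le> t" "t < T (Suc n)"
        using epoch_block[of T, OF T(1) t(1)] by blast
      have "m n \<le> x t" unfolding m_def block_inf_def using n by (intro cINF_lower bdd) auto
      moreover have "m k \<le> a" if "k < n" for k
        using that n not_less_Least[of k "\<lambda>j. a < m j"] by (auto simp: j_def)
      ultimately show ?thesis using t by (auto simp: falls_first_def intro!: exI[of _ n])
    qed (use t in \<open>auto simp: not_less\<close>)
  next
    assume "falls_first a m \<or> (\<exists>t\<ge>0. x t < 0) \<and> (\<forall>i. m i \<le> a)"
    then show "tau_below 0 x < tau_tilde_above a T x"
    proof
      assume "falls_first a m"
      then obtain n where n: "m n < 0" "\<And>k. k < n \<Longrightarrow> m k \<le> a" by (auto simp: falls_first_def)
      obtain t where t: "T n \<le> t" "t \<le> T (Suc n)" "x t < 0"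
        using n(1) cInf_lessD[of "x ` {T n..T (Suc n)}" 0] ne[of n] by (auto simp: m_def block_inf_def)
      have "tau_below 0 x \<le> ereal t"
        unfolding tau_below_def using t epochs_nonneg[OF T, of n] by (intro Inf_lower) auto
      also have "\<dots> \<le> ereal (T (Suc n))" using t by simp
      also have "\<dots> < tau_tilde_above a T x"
      proof (cases "\<exists>j. a < m j")
        case True
        define j where "j = (LEAST j. a < m j)"
        have "a < m j" unfolding j_def using True by (rule LeastI_ex)
        then have "n < j" using n a by (metis linorder_neqE_nat not_le order.strict_trans1 order_less_asym)
        then have "T (Suc n) < T (Suc j)" using T(2) by (simp add: strict_mono_def)
        then show ?thesis using True N by (simp add: tau_tilde_above_def epoch_at_def j_def)
      next
        case False
        then show ?thesis using N by (simp add: tau_tilde_above_def epoch_at_def)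
      qed
      finally show ?thesis .
    next
      assume "(\<exists>t\<ge>0. x t < 0) \<and> (\<forall>i. m i \<le> a)"
      then obtain t where t: "0 \<le> t" "x t < 0" and le: "\<forall>i. m i \<le> a" by auto
      then have "tau_below 0 x \<le> ereal t" unfolding tau_below_def by (intro Inf_lower) auto
      then show ?thesis using le N
        by (auto simp: tau_tilde_above_def epoch_at_def not_less[symmetric])
    qed
  qed
qed

text \<open>
  The dual statement for block suprema. If the first negative block supremum occurs at block \<open>n\<close>,
  the path is negative at the end of that block, hence stays below \<open>a\<close> for a positive amount of time
  afterwards; this gives the strict inequality between the two times.
\<close>

lemma tau_tilde_below_less_above_iff:
  fixes x T a
  defines "m \<equiv> block_sup T x"
  assumes T: "T 0 = 0" "strict_mono T" and x: "cadlag x" and a: "0 \<le> a"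
  shows "tau_tilde_below 0 T x < tau_above a x \<longleftrightarrow> falls_first a m"
proof -
  have N: "N_tilde_below 0 T x = (if \<exists>j. m j < 0 then enat (Suc (LEAST j. m j < 0)) else \<infinity>)"
    unfolding N_tilde_below_def m_def block_sup_def by (rule Inf_enat_Suc_eq)
  have bdd: "bdd_above (x ` {T i..T (Suc i)})" for i
    using cadlag_bounded_on[OF x epochs_nonneg[OF T]] by (rule bounded_imp_bdd_above)
  have ne: "{T i..T (Suc i)} \<noteq> {}" for i using T(2) by (auto simp: strict_mono_Suc_iff less_imp_le)
  have upper: "x t \<le> m i" if "T i \<le> t" "t \<le> T (Suc i)" for i t
    unfolding m_def block_sup_def using that by (intro cSUP_upper bdd) auto
  show ?thesis
  proof
    assume *: "tau_tilde_below 0 T x < tau_above a x"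
    then have ex: "\<exists>j. m j < 0"
      using N by (rule_tac ccontr) (simp add: tau_tilde_below_def epoch_at_def)
    define j where "j = (LEAST j. m j < 0)"
    have mj: "m j < 0" unfolding j_def using ex by (rule LeastI_ex)
    have lt: "ereal (T (Suc j)) < tau_above a x"
      using * ex N by (simp add: tau_tilde_below_def epoch_at_def j_def)
    have le: "x t \<le> a" if "0 \<le> t" "t \<le> T (Suc j)" for t
    proof (rule ccontr)
      assume "\<not> x t \<le> a"
      then have "tau_above a x \<le> ereal t" unfolding tau_above_def using that by (intro Inf_lower) auto
      also have "\<dots> \<le> ereal (T (Suc j))" using that by simp
      finally show False using lt by simp
    qed
    have "m k \<le> a" if "k < j" for k
      unfolding m_def block_sup_def
    proof (rule cSUP_least[OF ne])
      fix t assume "t \<in> {T k..T (Suc k)}"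
      moreover have "T (Suc k) \<le> T (Suc j)" using that T(2) by (simp add: strict_mono_leD)
      ultimately show "x t \<le> a" using epochs_nonneg[OF T, of k] by (intro le) auto
    qed
    then show "falls_first a m" using mj by (auto simp: falls_first_def)
  next
    assume "falls_first a m"
    then obtain n where n: "m n < 0" "\<And>k. k < n \<Longrightarrow> m k \<le> a" by (auto simp: falls_first_def)
    define j where "j = (LEAST j. m j < 0)"
    have "j \<le> n" unfolding j_def using n(1) by (rule Least_le)
    have "tau_tilde_below 0 T x = ereal (T (Suc j))"
      using n(1) N by (auto simp: tau_tilde_below_def epoch_at_def j_def)
    also have "\<dots> \<le> ereal (T (Suc n))" using \<open>j \<le> n\<close> T(2) by (simp add: strict_mono_leD)
    finally have 1: "tau_tilde_below 0 T x \<le> ereal (T (Suc n))" .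
    have Tn: "T n < T (Suc n)" using T(2) by (simp add: strict_mono_Suc_iff)
    have "(x \<longlongrightarrow> x (T (Suc n))) (at_right (T (Suc n)))"
      using x epochs_nonneg[OF T, of "Suc n"] by (auto simp: cadlag_def continuous_within)
    moreover have neg: "x (T (Suc n)) < 0" using upper[of n "T (Suc n)"] n Tn by auto
    ultimately have "\<forall>\<^sub>F t in at_right (T (Suc n)). x t < 0" by (rule order_tendstoD)
    then obtain c where c: "T (Suc n) < c" "\<And>t. T (Suc n) < t \<Longrightarrow> t < c \<Longrightarrow> x t < 0"
      by (auto simp: eventually_at_right_field)
    have le: "x t \<le> a" if t: "0 \<le> t" "t < c" for t
    proof (cases "t < T (Suc n)")
      case True
      then obtain i where i: "i < Suc n" "T i \<le> t" "t < T (Suc i)"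
        using epoch_block[of T, OF T(1) t(1)] by blast
      have "m i \<le> a" using i n a by (cases "i = n") auto
      then show ?thesis using upper[of i t] i by auto
    next
      case False
      then show ?thesis using c(2)[of t] neg a that by (cases "t = T (Suc n)") auto
    qed
    have "ereal c \<le> tau_above a x"
      unfolding tau_above_def
    proof (rule Inf_greatest, safe)
      fix t assume "0 \<le> t" "a < x t"
      then show "ereal c \<le> ereal t" using le[of t] by (cases "t < c") auto
    qed
    moreover have "ereal (T (Suc n)) < ereal c" using c by simp
    ultimately show "tau_tilde_below 0 T x < tau_above a x" using 1 by order
  qed
qed

section \<open>Partial sums of sequences\<close>

definition walk :: "(nat \<Rightarrow> real) \<Rightarrow> nat \<Rightarrow> real" where
  "walk x k = (\<Sum>j<k. x j)"

definition walk_min :: "(nat \<Rightarrow> real) \<Rightarrow> nat \<Rightarrow> real" where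
  "walk_min x n = Min (walk x ` {..n})"

definition walk_max :: "(nat \<Rightarrow> real) \<Rightarrow> nat \<Rightarrow> real" where
  "walk_max x n = Max (walk x ` {..n})"

definition shift :: "nat \<Rightarrow> (nat \<Rightarrow> real) \<Rightarrow> nat \<Rightarrow> real" where
  "shift m x = (\<lambda>j. x (m + j))"

lemma walk_0 [simp]: "walk x 0 = 0"
  by (simp add: walk_def)

lemma walk_shift: "walk (shift m x) k = walk x (m + k) - walk x m"
  by (induction k) (simp_all add: walk_def shift_def)

lemma walk_case_nat: "walk (case_nat y z) (Suc k) = y + walk z k"
  unfolding walk_def by (subst sum.lessThan_Suc_shift) simp

lemma walk_cong: "(\<And>j. j < k \<Longrightarrow> x j = y j) \<Longrightarrow> walk x k = walk y k"
  by (simp add: walk_def)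

lemma walk_min_le: "k \<le> n \<Longrightarrow> walk_min x n \<le> walk x k"
  by (simp add: walk_min_def)

lemma walk_min_attained: "\<exists>k\<le>n. walk x k = walk_min x n"
proof -
  have "walk_min x n \<in> walk x ` {..n}"
    unfolding walk_min_def by (rule Min_in) auto
  then show ?thesis by fastforce
qed

lemma walk_min_0 [simp]: "walk_min x 0 = 0"
  by (simp add: walk_min_def)

lemma walk_min_Suc: "walk_min x (Suc n) = min (walk x (Suc n)) (walk_min x n)"
  by (simp add: walk_min_def atMost_Suc)

lemma walk_max_uminus: "walk_max x n = - walk_min (\<lambda>j. - x j) n"
proof -
  have "walk_min (\<lambda>j. - x j) n = Min ((\<lambda>r. - r) ` walk x ` {..n})"
    by (simp add: walk_min_def walk_def sum_negf image_image)
  also have "\<dots> = - Max (walk x ` {..n})"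
    by (subst minus_Max_eq_Min) (simp_all add: image_image)
  finally show ?thesis by (simp add: walk_max_def del: minus_Max_eq_Min minus_Min_eq_Max)
qed

lemma measurable_walk [measurable (raw)]:
  assumes [measurable]: "f \<in> measurable N (PiM UNIV (\<lambda>_. borel))"
  shows "(\<lambda>z. walk (f z) k) \<in> borel_measurable N"
  unfolding walk_def by measurable

lemma measurable_shift [measurable (raw)]:
  assumes [measurable]: "f \<in> measurable N (PiM UNIV (\<lambda>_. borel))"
  shows "(\<lambda>z. shift m (f z)) \<in> measurable N (PiM UNIV (\<lambda>_. borel))"
  unfolding shift_def by (rule measurable_abs_UNIV) measurable

lemma measurable_walk_min [measurable (raw)]:
  assumes [measurable]: "f \<in> measurable N (PiM UNIV (\<lambda>_. borel))"
  shows "(\<lambda>z. walk_min (f z) k) \<in> borel_measurable N"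
  by (induction k) (simp_all add: walk_min_Suc)

lemma measurable_walk_max [measurable (raw)]:
  assumes [measurable]: "f \<in> measurable N (PiM UNIV (\<lambda>_. borel))"
  shows "(\<lambda>z. walk_max (f z) k) \<in> borel_measurable N"
proof -
  have [measurable]: "(\<lambda>z j. - f z j) \<in> measurable N (PiM UNIV (\<lambda>_. borel))"
    by (rule measurable_abs_UNIV) measurable
  show ?thesis unfolding walk_max_uminus by measurable
qed

section \<open>Walks with alternating step laws\<close>

definition alt_law :: "real measure \<Rightarrow> real measure \<Rightarrow> (nat \<Rightarrow> real) measure" where
  "alt_law \<alpha> \<beta> = PiM UNIV (\<lambda>i. if even i then \<alpha> else \<beta>)"

text \<open>
  Every probability in the theorem is of this form: the walk is observed at all even times
  (\<open>c = 0\<close>) or at all odd times (\<open>c = 1\<close>). The parameter \<open>c\<close> is left free since conditioning on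
  one step lowers it by one.
\<close>

definition alt_falls :: "real \<Rightarrow> real measure \<Rightarrow> real measure \<Rightarrow> nat \<Rightarrow> real \<Rightarrow> real" where
  "alt_falls a \<alpha> \<beta> c v =
     measure (alt_law \<alpha> \<beta>) {z. falls_first a (\<lambda>i. v + walk z (2 * i + c))}"

lemma sets_alt_law:
  "sets \<alpha> = sets borel \<Longrightarrow> sets \<beta> = sets borel \<Longrightarrow>
    sets (alt_law \<alpha> \<beta>) = sets (PiM UNIV (\<lambda>_. borel))"
  unfolding alt_law_def by (intro sets_PiM_cong) auto

text \<open>
  A sequence of independent variables is its first entry together with the independent sequence of
  the remaining ones; the entries need not be identically distributed.
\<close>

lemma PiM_case_nat:
  assumes "\<And>i. prob_space (N i)"
  shows "distr (N 0 \<Otimes>\<^sub>M PiM UNIV (\<lambda>i. N (Suc i))) (PiM UNIV N) (\<lambda>(s, \<omega>). case_nat s \<omega>) = PiM UNIV N"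
    (is "?D = _")
proof -
  interpret P: product_prob_space N UNIV
    by (intro product_prob_spaceI assms)
  interpret P': product_prob_space "\<lambda>i. N (Suc i)" UNIV
    by (intro product_prob_spaceI assms)
  have meas: "(\<lambda>(s, \<omega>). case_nat s \<omega>) \<in> measurable (N 0 \<Otimes>\<^sub>M PiM UNIV (\<lambda>i. N (Suc i))) (PiM UNIV N)"
    unfolding split_beta'
  proof (rule measurable_abs_UNIV)
    show "(\<lambda>p. case n of 0 \<Rightarrow> fst p | Suc i \<Rightarrow> snd p i) \<in>
        measurable (N 0 \<Otimes>\<^sub>M PiM UNIV (\<lambda>i. N (Suc i))) (N n)" for n
      by (cases n) simp_all
  qed
  show ?thesis
  proof (rule P.PiM_eq)
    fix J E assume J: "finite J" "J \<subseteq> UNIV" "\<And>j. j \<in> J \<Longrightarrow> E j \<in> sets (N j)"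
    let ?X = "prod_emb UNIV N J (\<Pi>\<^sub>E j\<in>J. E j)"
    let ?E = "if 0 \<in> J then E 0 else space (N 0)"
    let ?F = "prod_emb UNIV (\<lambda>i. N (Suc i)) (Suc -` J) (\<Pi>\<^sub>E j\<in>Suc -` J. E (Suc j))"
    have sub: "\<And>j x. j \<in> J \<Longrightarrow> x \<in> E j \<Longrightarrow> x \<in> space (N j)"
      using J(3)[THEN sets.sets_into_space] by (auto simp: subset_eq)
    have fin: "finite (Suc -` J)" using J by (simp add: finite_vimageI)
    have "(\<lambda>(s, \<omega>). case_nat s \<omega>) -` ?X \<inter> space (N 0 \<Otimes>\<^sub>M PiM UNIV (\<lambda>i. N (Suc i))) = ?E \<times> ?F"
      using sub
      by (auto simp: space_pair_measure space_PiM PiE_iff prod_emb_def all_conj_distrib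
          split: nat.split nat.split_asm)
    then have "emeasure ?D ?X = emeasure (N 0 \<Otimes>\<^sub>M PiM UNIV (\<lambda>i. N (Suc i))) (?E \<times> ?F)"
      by (subst emeasure_distr[OF meas]) (auto intro!: sets_PiM_I simp: J)
    also have "\<dots> = emeasure (N 0) ?E * emeasure (PiM UNIV (\<lambda>i. N (Suc i))) ?F"
      using J fin by (intro P'.emeasure_pair_measure_Times) (auto intro!: sets_PiM_I)
    also have "emeasure (PiM UNIV (\<lambda>i. N (Suc i))) ?F = (\<Prod>j\<in>Suc -` J. emeasure (N (Suc j)) (E (Suc j)))"
      using J fin by (intro P'.emeasure_PiM_emb) simp_all
    also have "\<dots> = (\<Prod>j\<in>J - {0}. emeasure (N j) (E j))"
      by (rule prod.reindex_cong [of "\<lambda>x. x - 1"])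
        (auto simp: image_iff Suc_pred' intro!: inj_onI bexI[of _ "Suc _"])
    also have "emeasure (N 0) ?E * (\<Prod>j\<in>J - {0}. emeasure (N j) (E j)) = (\<Prod>j\<in>J. emeasure (N j) (E j))"
      by (auto simp: J prod.remove prob_space.emeasure_space_1[OF assms])
    finally show "emeasure ?D ?X = (\<Prod>j\<in>J. emeasure (N j) (E j))" .
  qed simp
qed

lemma falls_first_Suc:
  assumes "0 \<le> w 0" "w 0 \<le> a"
  shows "falls_first a w \<longleftrightarrow> falls_first a (\<lambda>i. w (Suc i))"
proof
  assume "falls_first a w"
  then obtain n where n: "w n < 0" "\<And>k. k < n \<Longrightarrow> w k \<le> a" by (auto simp: falls_first_def)
  with assms obtain m where "n = Suc m" by (cases n) auto
  with n show "falls_first a (\<lambda>i. w (Suc i))" by (auto simp: falls_first_def intro!: exI[of _ m])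
next
  assume "falls_first a (\<lambda>i. w (Suc i))"
  then obtain n where n: "w (Suc n) < 0" "\<And>k. k < n \<Longrightarrow> w (Suc k) \<le> a" by (auto simp: falls_first_def)
  have "w k \<le> a" if "k < Suc n" for k using that assms n by (cases k) auto
  with n show "falls_first a w" by (auto simp: falls_first_def intro!: exI[of _ "Suc n"])
qed

text \<open>
  A start inside \<open>{0..a}\<close> neither triggers nor prevents the event, so the observation at time 0 can
  be skipped.
\<close>

lemma alt_falls_0_eq_2:
  assumes "u \<in> {0..a}"
  shows "alt_falls a \<alpha> \<beta> 0 u = alt_falls a \<alpha> \<beta> 2 u"
  unfolding alt_falls_def using falls_first_Suc[of "\<lambda>i. u + walk _ (2 * i + 0)" a] assms by simp

lemma measurable_falls_first [measurable (raw)]: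
  assumes [measurable]: "\<And>i. (\<lambda>z. w z i) \<in> borel_measurable N"
  shows "Measurable.pred N (\<lambda>z. falls_first a (w z))"
  unfolding falls_first_def by measurable

text \<open>
  Conditioning on the first step: it moves the starting point, and the remaining walk has the two
  step laws interchanged.
\<close>

lemma alt_falls_Suc:
  assumes \<alpha>: "prob_space \<alpha>" "sets \<alpha> = sets borel" and \<beta>: "prob_space \<beta>" "sets \<beta> = sets borel"
  shows measurable_alt_falls: "(\<lambda>x. alt_falls a \<beta> \<alpha> c (v + x)) \<in> borel_measurable borel"
    and "alt_falls a \<alpha> \<beta> (Suc c) v = (\<integral>x. alt_falls a \<beta> \<alpha> c (v + x) \<partial>\<alpha>)"
proof -
  let ?N = "\<lambda>i. if even i then \<alpha> else \<beta>"
  interpret \<alpha>: prob_space \<alpha> by fact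
  interpret B: prob_space "alt_law \<beta> \<alpha>"
    unfolding alt_law_def by (rule prob_space_PiM) (use assms in auto)
  interpret A: prob_space "alt_law \<alpha> \<beta>"
    unfolding alt_law_def by (rule prob_space_PiM) (use assms in auto)
  note [measurable_cong] = sets_alt_law[OF \<alpha>(2) \<beta>(2)] sets_alt_law[OF \<beta>(2) \<alpha>(2)] \<alpha>(2)
  have space: "space (alt_law \<alpha> \<beta>) = UNIV" "space (alt_law \<beta> \<alpha>) = UNIV" "space \<alpha> = UNIV"
    using sets_alt_law[OF \<alpha>(2) \<beta>(2), THEN sets_eq_imp_space_eq] sets_alt_law[OF \<beta>(2) \<alpha>(2), THEN sets_eq_imp_space_eq]
      \<alpha>(2)[THEN sets_eq_imp_space_eq]
    by (auto simp: space_PiM)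
  define E where "E = {p \<in> space (borel \<Otimes>\<^sub>M alt_law \<beta> \<alpha>). falls_first a (\<lambda>i. v + fst p + walk (snd p) (2 * i + c))}"
  have E [measurable]: "E \<in> sets (borel \<Otimes>\<^sub>M alt_law \<beta> \<alpha>)" unfolding E_def by measurable
  have slice: "Pair x -` E = {z. falls_first a (\<lambda>i. v + x + walk z (2 * i + c))}" for x
    by (auto simp: E_def space_pair_measure space)
  have f: "alt_falls a \<beta> \<alpha> c (v + x) = measure (alt_law \<beta> \<alpha>) (Pair x -` E)" for x
    unfolding alt_falls_def slice ..
  have "(\<lambda>x. emeasure (alt_law \<beta> \<alpha>) (Pair x -` E)) \<in> borel_measurable borel"
    by (rule B.measurable_emeasure_Pair[OF E])
  then show meas: "(\<lambda>x. alt_falls a \<beta> \<alpha> c (v + x)) \<in> borel_measurable borel"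
    unfolding f measure_def by measurable
  have swap: "(\<lambda>i. ?N (Suc i)) = (\<lambda>i. if even i then \<beta> else \<alpha>)" by auto
  have D: "alt_law \<alpha> \<beta> = distr (\<alpha> \<Otimes>\<^sub>M alt_law \<beta> \<alpha>) (alt_law \<alpha> \<beta>) (\<lambda>(s, \<omega>). case_nat s \<omega>)"
    using PiM_case_nat[of ?N] assms unfolding swap alt_law_def by auto
  have [measurable]: "(\<lambda>(s, \<omega>). case_nat s \<omega>) \<in> measurable (\<alpha> \<Otimes>\<^sub>M alt_law \<beta> \<alpha>) (PiM UNIV (\<lambda>_. borel))"
    unfolding split_beta'
  proof (rule measurable_abs_UNIV)
    show "(\<lambda>p. case n of 0 \<Rightarrow> fst p | Suc i \<Rightarrow> snd p i) \<in> borel_measurable (\<alpha> \<Otimes>\<^sub>M alt_law \<beta> \<alpha>)" for n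
      by (cases n) simp_all
  qed
  have F: "{z \<in> space (PiM UNIV (\<lambda>_. borel)). falls_first a (\<lambda>i. v + walk z (2 * i + Suc c))} \<in> sets (PiM UNIV (\<lambda>_. borel))"
    by measurable
  then have F [measurable]: "{z. falls_first a (\<lambda>i. v + walk z (2 * i + Suc c))} \<in> sets (PiM UNIV (\<lambda>_. borel))"
    by (simp add: space_PiM)
  have "ennreal (alt_falls a \<alpha> \<beta> (Suc c) v) =
      emeasure (alt_law \<alpha> \<beta>) {z. falls_first a (\<lambda>i. v + walk z (2 * i + Suc c))}"
    by (simp add: alt_falls_def A.emeasure_eq_measure)
  also have "\<dots> = emeasure (\<alpha> \<Otimes>\<^sub>M alt_law \<beta> \<alpha>)
      ((\<lambda>(s, \<omega>). case_nat s \<omega>) -` {z. falls_first a (\<lambda>i. v + walk z (2 * i + Suc c))} \<inter> space (\<alpha> \<Otimes>\<^sub>M alt_law \<beta> \<alpha>))"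
    by (subst D, subst emeasure_distr) measurable
  also have "(\<lambda>(s, \<omega>). case_nat s \<omega>) -` {z. falls_first a (\<lambda>i. v + walk z (2 * i + Suc c))} \<inter> space (\<alpha> \<Otimes>\<^sub>M alt_law \<beta> \<alpha>) = E"
    by (auto simp: E_def space_pair_measure space walk_case_nat add.assoc)
  also have "emeasure (\<alpha> \<Otimes>\<^sub>M alt_law \<beta> \<alpha>) E = (\<integral>\<^sup>+x. emeasure (alt_law \<beta> \<alpha>) (Pair x -` E) \<partial>\<alpha>)"
    using E sets_pair_measure_cong[OF \<alpha>(2) refl, of "alt_law \<beta> \<alpha>"]
    by (intro B.emeasure_pair_measure_alt) simp
  also have "\<dots> = (\<integral>\<^sup>+x. ennreal (alt_falls a \<beta> \<alpha> c (v + x)) \<partial>\<alpha>)"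
    by (simp add: f B.emeasure_eq_measure)
  also have "\<dots> = ennreal (\<integral>x. alt_falls a \<beta> \<alpha> c (v + x) \<partial>\<alpha>)"
  proof (rule nn_integral_eq_integral)
    show "integrable \<alpha> (\<lambda>x. alt_falls a \<beta> \<alpha> c (v + x))"
      using meas by (intro \<alpha>.integrable_const_bound[of _ 1])
        (auto simp: alt_falls_def measurable_cong_sets[OF \<alpha>(2) refl])
  qed (simp add: alt_falls_def)
  finally show "alt_falls a \<alpha> \<beta> (Suc c) v = (\<integral>x. alt_falls a \<beta> \<alpha> c (v + x) \<partial>\<alpha>)"
    by (subst (asm) ennreal_inj) (auto simp: alt_falls_def)
qed

section \<open>Random walks at geometric times\<close>

lemma ennreal_Cauchy_product:
  fixes f g :: "nat \<Rightarrow> ennreal"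
  shows "(\<Sum>n. \<Sum>j\<le>n. f j * g (n - j)) = (\<Sum>j. f j) * (\<Sum>l. g l)"
proof -
  let ?h = "\<lambda>j n. if j \<le> n then f j * g (n - j) else 0"
  have "(\<Sum>n. \<Sum>j\<le>n. f j * g (n - j)) = (\<Sum>n. \<Sum>j. ?h j n)"
    by (intro suminf_cong, subst suminf_finite[of "{.._}"]) (auto intro!: sum.cong)
  also have "\<dots> = (\<Sum>j. \<Sum>n. ?h j n)"
    using nn_integral_suminf[of ?h "count_space UNIV"] by (simp add: nn_integral_count_space_nat)
  also have "\<dots> = (\<Sum>j. f j * (\<Sum>l. g l))"
  proof (rule suminf_cong)
    fix j
    have "(\<Sum>n. ?h j n) = (\<Sum>l. ?h j (j + l))"
      by (rule suminf_mono_reindex[symmetric])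
        (auto simp: strict_mono_def image_iff dest: le_Suc_ex)
    then show "(\<Sum>n. ?h j n) = f j * (\<Sum>l. g l)" by simp
  qed
  finally show ?thesis by simp
qed

text \<open>
  With \<open>stays_nonneg\<close> below, the two halves of a path cut at the time \<open>j\<close> of its first minimum: up
  to \<open>j\<close> all earlier values are strictly larger, after \<open>j\<close> no value is smaller.
\<close>

definition strict_descent :: "(nat \<Rightarrow> real) \<Rightarrow> nat \<Rightarrow> bool" where
  "strict_descent x j \<longleftrightarrow> (\<forall>i<j. walk x j < walk x i)"

definition stays_nonneg :: "(nat \<Rightarrow> real) \<Rightarrow> nat \<Rightarrow> bool" where
  "stays_nonneg x l \<longleftrightarrow> (\<forall>i\<le>l. 0 \<le> walk x i)"

text \<open>
  Exactly one summand on the right is nonzero, namely the one belonging to the first time at which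
  the minimum is attained.
\<close>

lemma first_minimum_decomposition:
  fixes G H :: "real \<Rightarrow> ennreal"
  shows "G (walk_min x n) * H (walk x n - walk_min x n) =
    (\<Sum>j\<le>n. (if strict_descent x j then G (walk x j) else 0) *
       (if stays_nonneg (shift j x) (n - j) then H (walk (shift j x) (n - j)) else 0))"
    (is "?L = (\<Sum>j\<le>n. ?R j)")
proof -
  define J where "J = (LEAST j. walk x j = walk_min x n)"
  obtain k where k: "k \<le> n" "walk x k = walk_min x n" using walk_min_attained by blast
  have J: "walk x J = walk_min x n" unfolding J_def using k(2) by (rule LeastI)
  have Jn: "J \<le> n" using Least_le[of "\<lambda>j. walk x j = walk_min x n" k] k by (simp add: J_def)
  have before: "walk_min x n < walk x i" if "i < J" for i
    using walk_min_le[of i n x] not_less_Least[of i "\<lambda>j. walk x j = walk_min x n"] that Jn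
    by (simp add: J_def)
  have RJ: "?R J = ?L"
  proof -
    have "strict_descent x J" using before J by (simp add: strict_descent_def)
    moreover have "stays_nonneg (shift J x) (n - J)"
      using J Jn walk_min_le[of _ n x] by (simp add: stays_nonneg_def walk_shift)
    ultimately show ?thesis using J Jn by (simp add: walk_shift)
  qed
  have "?R j = 0" if "j \<le> n" "j \<noteq> J" for j
  proof (cases "j < J")
    case True
    have "\<not> stays_nonneg (shift j x) (n - j)"
      using True Jn J before[OF True]
      by (auto simp: stays_nonneg_def walk_shift not_le intro!: exI[of _ "J - j"])
    then show ?thesis by simp
  next
    case False
    then have "J < j" using that by simp
    then have "\<not> strict_descent x j"
      using J walk_min_le[OF that(1), of x] by (auto simp: strict_descent_def not_less intro!: exI[of _ J])
    then show ?thesis by simp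
  qed
  then have "(\<Sum>j\<le>n. ?R j) = (\<Sum>j\<le>n. if j = J then ?L else 0)"
    using RJ by (intro sum.cong) auto
  then show ?thesis using Jn by simp
qed

locale iid_steps = sequence_space M for M :: "real measure" +
  assumes sets_M: "sets M = sets borel"
begin

lemma sets_S [measurable_cong]: "sets S = sets (PiM UNIV (\<lambda>_. borel))"
  by (intro sets_PiM_cong) (auto simp: sets_M)

text \<open>
  A function of the first \<open>m\<close> steps and a function of the later steps are independent. The
  hypothesis on \<open>f\<close> says that it depends on the first \<open>m\<close> steps only.
\<close>

lemma nn_integral_split:
  assumes [measurable]: "f \<in> borel_measurable S" "g \<in> borel_measurable S"
    and f: "\<And>x y. (\<And>j. j < m \<Longrightarrow> x j = y j) \<Longrightarrow> f x = f y"
  shows "(\<integral>\<^sup>+x. f x * g (shift m x) \<partial>S) = (\<integral>\<^sup>+x. f x \<partial>S) * (\<integral>\<^sup>+x. (g x :: ennreal) \<partial>S)"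
proof -
  have [measurable]: "(\<lambda>x. g (shift m x)) \<in> borel_measurable S"
    by (rule measurable_compose[of "shift m" S S]) measurable
  have "(\<integral>\<^sup>+x. f x * g (shift m x) \<partial>S) =
      (\<integral>\<^sup>+x. f x * g (shift m x) \<partial>distr (S \<Otimes>\<^sub>M S) S (\<lambda>(\<omega>, \<omega>'). comb_seq m \<omega> \<omega>'))"
    unfolding PiM_comb_seq ..
  also have "\<dots> = (\<integral>\<^sup>+p. f (comb_seq m (fst p) (snd p)) * g (shift m (comb_seq m (fst p) (snd p))) \<partial>(S \<Otimes>\<^sub>M S))"
    by (subst nn_integral_distr[OF measurable_comb_seq]) (simp_all add: split_beta')
  also have "\<dots> = (\<integral>\<^sup>+p. f (fst p) * g (snd p) \<partial>(S \<Otimes>\<^sub>M S))"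
    by (intro nn_integral_cong arg_cong2[where f="(*)"] f arg_cong[where f=g])
      (auto simp: comb_seq_def shift_def)
  also have "\<dots> = (\<integral>\<^sup>+x. f x * (\<integral>\<^sup>+y. g y \<partial>S) \<partial>S)"
    by (subst P.nn_integral_fst[symmetric]) (simp_all add: nn_integral_cmult)
  finally show ?thesis by (simp add: nn_integral_multc)
qed

lemma nn_integral_shift:
  assumes [measurable]: "g \<in> borel_measurable S"
  shows "(\<integral>\<^sup>+x. g (shift m x) \<partial>S) = (\<integral>\<^sup>+x. (g x :: ennreal) \<partial>S)"
  using nn_integral_split[of "\<lambda>_. 1" g m] by (simp add: P.emeasure_space_1)

text \<open>
  Duality: reading the first \<open>n\<close> steps backwards preserves the law and turns the rise of the walk
  above its minimum into its maximum.
\<close>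

lemma nn_integral_reverse:
  assumes [measurable]: "H \<in> borel_measurable borel"
  shows "(\<integral>\<^sup>+x. H (walk x n - walk_min x n) \<partial>S) = (\<integral>\<^sup>+x. H (walk_max x n) \<partial>S)"
proof -
  define r where "r j = (if j < n then n - 1 - j else j)" for j
  have "inj r" by (auto simp: inj_on_def r_def split: if_splits)
  then have D: "distr S S (\<lambda>x j. x (r j)) = S"
    using distr_PiM_reindex[of UNIV "\<lambda>_. M" r UNIV] by (simp add: M.prob_space_axioms restrict_UNIV)
  have [measurable]: "(\<lambda>x j. x (r j)) \<in> measurable S S"
    by (rule measurable_abs_UNIV) measurable
  have w: "walk (\<lambda>j. x (r j)) k = walk x n - walk x (n - k)" if "k \<le> n" for x k
    using that
  proof (induction k)
    case (Suc k)
    have "n - k = Suc (n - Suc k)" using Suc.prems by simp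
    then have "walk x (n - k) = walk x (n - Suc k) + x (n - Suc k)" by (simp add: walk_def)
    moreover have "walk (\<lambda>j. x (r j)) (Suc k) = walk (\<lambda>j. x (r j)) k + x (n - Suc k)"
      using Suc.prems by (simp add: walk_def r_def)
    ultimately show ?case using Suc by simp
  qed simp
  have max: "walk_max (\<lambda>j. x (r j)) n = walk x n - walk_min x n" for x
    unfolding walk_max_def
  proof (rule Max_eqI)
    fix y assume "y \<in> walk (\<lambda>j. x (r j)) ` {..n}"
    then show "y \<le> walk x n - walk_min x n" using walk_min_le[of _ n x] by (auto simp: w)
  next
    obtain k where "k \<le> n" "walk x k = walk_min x n" using walk_min_attained by blast
    then show "walk x n - walk_min x n \<in> walk (\<lambda>j. x (r j)) ` {..n}"
      by (intro image_eqI[of _ _ "n - k"]) (auto simp: w)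
  qed simp
  have "(\<integral>\<^sup>+x. H (walk_max x n) \<partial>S) = (\<integral>\<^sup>+x. H (walk_max x n) \<partial>distr S S (\<lambda>x j. x (r j)))"
    unfolding D ..
  also have "\<dots> = (\<integral>\<^sup>+x. H (walk x n - walk_min x n) \<partial>S)"
    by (subst nn_integral_distr) (simp_all add: max)
  finally show ?thesis ..
qed

text \<open>
  The Wiener-Hopf factorization in its simplest instance: at an independent geometric time the
  minimum of a walk and the rise above the minimum are independent, and the rise is distributed
  like the maximum. Splitting at the first minimum gives a convolution in \<open>n\<close>, which the geometric
  weights \<open>c * p ^ n\<close> turn into a product \<open>F G H = c * A G * B H\<close>. Since \<open>F 1 1 = 1\<close>, the product
  structure alone implies \<open>F G H = F G 1 * F 1 H\<close>.
\<close>

lemma Wiener_Hopf_geometric: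
  fixes c p :: ennreal
  assumes q: "(\<Sum>n. c * p ^ n) = 1"
    and [measurable]: "G \<in> borel_measurable borel" "H \<in> borel_measurable borel"
  shows "(\<Sum>n. c * p ^ n * (\<integral>\<^sup>+x. G (walk_min x n) * H (walk x n - walk_min x n) \<partial>S)) =
    (\<Sum>n. c * p ^ n * (\<integral>\<^sup>+x. G (walk_min x n) \<partial>S)) * (\<Sum>n. c * p ^ n * (\<integral>\<^sup>+x. H (walk_max x n) \<partial>S))"
proof -
  define A where "A G j = (\<integral>\<^sup>+x. (if strict_descent x j then G (walk x j) else 0) \<partial>S)"
    for G :: "real \<Rightarrow> ennreal" and j
  define B where "B H l = (\<integral>\<^sup>+x. (if stays_nonneg x l then H (walk x l) else 0) \<partial>S)"
    for H :: "real \<Rightarrow> ennreal" and l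
  define F where "F G H = (\<Sum>n. c * p ^ n * (\<integral>\<^sup>+x. G (walk_min x n) * H (walk x n - walk_min x n) \<partial>S))"
    for G H
  have F: "F G H = c * (\<Sum>j. p ^ j * A G j) * (\<Sum>l. p ^ l * B H l)"
    if [measurable]: "G \<in> borel_measurable borel" "H \<in> borel_measurable borel" for G H
  proof -
    have sp: "(\<integral>\<^sup>+x. (if strict_descent x j then G (walk x j) else 0) *
        (if stays_nonneg (shift j x) l then H (walk (shift j x) l) else 0) \<partial>S) = A G j * B H l" for j l
      unfolding A_def B_def
    proof (rule nn_integral_split)
      show "(\<lambda>x. if strict_descent x j then G (walk x j) else 0) \<in> borel_measurable S"
        unfolding strict_descent_def by measurable
      show "(\<lambda>x. if stays_nonneg x l then H (walk x l) else 0) \<in> borel_measurable S"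
        unfolding stays_nonneg_def by measurable
      fix x y :: "nat \<Rightarrow> real" assume xy: "\<And>i. i < j \<Longrightarrow> x i = y i"
      have eq: "walk x k = walk y k" if "k \<le> j" for k using that by (intro walk_cong xy) simp
      then have "strict_descent x j = strict_descent y j" by (auto simp: strict_descent_def)
      then show "(if strict_descent x j then G (walk x j) else 0) = (if strict_descent y j then G (walk y j) else 0)"
        by (simp add: eq)
    qed
    have m1: "(\<lambda>x. (if strict_descent x j then G (walk x j) else 0) *
        (if stays_nonneg (shift j x) l then H (walk (shift j x) l) else 0)) \<in> borel_measurable S" for j l
      unfolding strict_descent_def stays_nonneg_def by measurable
    have "(\<integral>\<^sup>+x. G (walk_min x n) * H (walk x n - walk_min x n) \<partial>S) = (\<Sum>j\<le>n. A G j * B H (n - j))" for n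
      unfolding first_minimum_decomposition by (subst nn_integral_sum) (simp_all add: m1 sp)
    then have "F G H = (\<Sum>n. c * (\<Sum>j\<le>n. (p ^ j * A G j) * (p ^ (n - j) * B H (n - j))))"
      unfolding F_def
      by (intro suminf_cong)
        (auto simp: sum_distrib_left mult_ac power_add[symmetric] intro!: sum.cong
          simp flip: mult.assoc[of "p ^ _" "p ^ _"])
    also have "\<dots> = c * ((\<Sum>j. p ^ j * A G j) * (\<Sum>l. p ^ l * B H l))"
      using ennreal_Cauchy_product[of "\<lambda>j. p ^ j * A G j" "\<lambda>l. p ^ l * B H l"] by simp
    finally show ?thesis by (simp add: mult.assoc)
  qed
  \<comment> \<open>total mass of the geometric law\<close>
  have one: "F (\<lambda>_. 1) (\<lambda>_. 1) = 1"
    using q by (simp add: F_def P.emeasure_space_1)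
  have "F G H = F G H * F (\<lambda>_. 1) (\<lambda>_. 1)" by (simp add: one)
  also have "\<dots> = F G (\<lambda>_. 1) * F (\<lambda>_. 1) H" by (simp add: F mult_ac)
  also have "F G (\<lambda>_. 1) = (\<Sum>n. c * p ^ n * (\<integral>\<^sup>+x. G (walk_min x n) \<partial>S))"
    by (simp add: F_def)
  also have "F (\<lambda>_. 1) H = (\<Sum>n. c * p ^ n * (\<integral>\<^sup>+x. H (walk_max x n) \<partial>S))"
    by (simp add: F_def nn_integral_reverse)
  finally show ?thesis by (simp add: F_def)
qed

end

text \<open>
  Block \<open>i\<close> uses \<open>Suc (\<kappa> i)\<close> consecutive steps: one step leading to its first grid point and \<open>\<kappa> i\<close>
  steps inside the block. Only the latter enter the block functionals, so that a geometric number of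
  steps starting from 0, as needed for the factorization, is observed.
\<close>

definition block_start :: "(nat \<Rightarrow> nat) \<Rightarrow> nat \<Rightarrow> nat" where
  "block_start \<kappa> i = (\<Sum>l<i. Suc (\<kappa> l))"

lemma block_start_Suc: "block_start \<kappa> (Suc i) = Suc (block_start \<kappa> i + \<kappa> i)"
  by (simp add: block_start_def)

lemma block_start_mono: "i \<le> j \<Longrightarrow> block_start \<kappa> i \<le> block_start \<kappa> j"
  unfolding block_start_def by (intro sum_mono2) auto

lemma (in iid_steps) nn_integral_blocks:
  fixes \<psi> :: "nat \<Rightarrow> nat \<Rightarrow> (nat \<Rightarrow> real) \<Rightarrow> ennreal"
  assumes [measurable]: "\<And>i k. \<psi> i k \<in> borel_measurable S"
    and local: "\<And>i k x y. (\<And>j. j < k \<Longrightarrow> x j = y j) \<Longrightarrow> \<psi> i k x = \<psi> i k y"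
  shows "(\<integral>\<^sup>+x. (\<Prod>i<n. \<psi> i (\<kappa> i) (shift (Suc (block_start \<kappa> i)) x)) \<partial>S) = (\<Prod>i<n. \<integral>\<^sup>+x. \<psi> i (\<kappa> i) x \<partial>S)"
proof (induction n)
  case (Suc n)
  have [measurable]: "(\<lambda>x. \<psi> i k (shift m x)) \<in> borel_measurable S" for i k m
    by (rule measurable_compose[of "shift m" S S]) measurable
  have shift_shift: "shift m (shift l x) = shift (l + m) x" for m l x
    by (simp add: shift_def add.assoc)
  have "(\<integral>\<^sup>+x. (\<Prod>i<n. \<psi> i (\<kappa> i) (shift (Suc (block_start \<kappa> i)) x)) *
       \<psi> n (\<kappa> n) (shift 1 (shift (block_start \<kappa> n) x)) \<partial>S) =
     (\<integral>\<^sup>+x. (\<Prod>i<n. \<psi> i (\<kappa> i) (shift (Suc (block_start \<kappa> i)) x)) \<partial>S) * (\<integral>\<^sup>+x. \<psi> n (\<kappa> n) (shift 1 x) \<partial>S)"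
  proof (rule nn_integral_split)
    fix x y :: "nat \<Rightarrow> real" assume xy: "\<And>j. j < block_start \<kappa> n \<Longrightarrow> x j = y j"
    show "(\<Prod>i<n. \<psi> i (\<kappa> i) (shift (Suc (block_start \<kappa> i)) x)) = (\<Prod>i<n. \<psi> i (\<kappa> i) (shift (Suc (block_start \<kappa> i)) y))"
    proof (rule prod.cong[OF refl], rule local)
      fix i j assume "i \<in> {..<n}" "j < \<kappa> i"
      then have "Suc (block_start \<kappa> i) + j < block_start \<kappa> n"
        using block_start_mono[of "Suc i" n \<kappa>] by (simp add: block_start_Suc)
      then show "shift (Suc (block_start \<kappa> i)) x j = shift (Suc (block_start \<kappa> i)) y j"
        unfolding shift_def by (rule xy)
    qed
  qed measurable
  then show ?case
    using Suc nn_integral_shift[of "\<psi> n (\<kappa> n)" 1] by (simp add: shift_shift)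
qed (simp add: P.emeasure_space_1)

section \<open>Laws from test functions\<close>

lemma (in prob_space) distr_eq_PiM_atMost:
  fixes Z W :: "nat \<Rightarrow> 'a \<Rightarrow> real"
  assumes [measurable]: "\<And>j. Z j \<in> borel_measurable M" "\<And>j. W j \<in> borel_measurable M"
    and eq: "\<And>J x. finite J \<Longrightarrow>
      emeasure M {\<omega> \<in> space M. \<forall>j\<in>J. Z j \<omega> \<le> x j} = (\<Prod>j\<in>J. emeasure M {\<omega> \<in> space M. W j \<omega> \<le> x j})"
  shows "distr M (PiM UNIV (\<lambda>_. borel)) (\<lambda>\<omega> j. Z j \<omega>) = PiM UNIV (\<lambda>j. distr M borel (W j))"
proof -
  have law: "distr M borel (Z j) = distr M borel (W j)" for j
  proof (rule cdf_unique)
    show "real_distribution (distr M borel (Z j))" "real_distribution (distr M borel (W j))"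
      by (simp_all add: real_distribution_distr)
    have "measure M {\<omega> \<in> space M. Z j \<omega> \<le> x} = measure M {\<omega> \<in> space M. W j \<omega> \<le> x}" for x
      using eq[of "{j}" "\<lambda>_. x"] by (simp add: measure_def)
    then show "cdf (distr M borel (Z j)) = cdf (distr M borel (W j))"
      by (simp add: fun_eq_iff cdf_def measure_distr vimage_def Int_def conj_commute)
  qed
  have eq': "prob {\<omega> \<in> space M. \<forall>j\<in>J. Z j \<omega> \<le> x j} = (\<Prod>j\<in>J. prob {\<omega> \<in> space M. Z j \<omega> \<le> x j})"
    if "finite J" for J x
  proof -
    have "emeasure M {\<omega> \<in> space M. W j \<omega> \<le> r} = emeasure M {\<omega> \<in> space M. Z j \<omega> \<le> r}" for j r
      using eq[of "{j}" "\<lambda>_. r"] by simp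
    then have "ennreal (prob {\<omega> \<in> space M. \<forall>j\<in>J. Z j \<omega> \<le> x j}) = ennreal (\<Prod>j\<in>J. prob {\<omega> \<in> space M. Z j \<omega> \<le> x j})"
      using eq[OF that, of x] by (simp add: emeasure_eq_measure prod_ennreal)
    then show ?thesis by (simp add: prod_nonneg)
  qed
  have "indep_vars (\<lambda>_. borel) Z J" if J: "J \<noteq> {}" "finite J" for J
  proof (subst indep_vars_finite[where E="\<lambda>_. insert UNIV (range (\<lambda>x. {..x}))"])
    show "\<And>i. sets borel = sigma_sets (space borel) (insert UNIV (range (\<lambda>x::real. {..x})))"
    proof -
      have "sigma_sets UNIV (insert UNIV (range (\<lambda>x::real. {..x}))) = sigma_sets UNIV (range (\<lambda>x::real. {..x}))"
        by (intro sigma_sets_eqI) (auto intro: sigma_sets_top)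
      then show "\<And>i. sets borel = sigma_sets (space borel) (insert UNIV (range (\<lambda>x::real. {..x})))"
        unfolding borel_eq_atMost by simp
    qed
    show "Int_stable (insert UNIV (range (\<lambda>x::real. {..x})))"
      by (auto simp: Int_stable_def)
    show "\<forall>A\<in>J \<rightarrow> insert UNIV (range (\<lambda>x. {..x})).
       prob ((\<Inter>j\<in>J. Z j -` A j \<inter> space M)) = (\<Prod>j\<in>J. prob (Z j -` A j \<inter> space M))"
    proof
      fix A assume A: "A \<in> J \<rightarrow> insert UNIV (range (\<lambda>x::real. {..x}))"
      \<comment> \<open>the indices that carry a genuine half-line\<close>
      define K where "K = {j\<in>J. A j \<noteq> UNIV}"
      have "\<forall>j\<in>K. \<exists>x. A j = {..x}" using A by (auto simp: K_def Pi_iff)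
      then obtain x where x: "\<And>j. j \<in> K \<Longrightarrow> A j = {..x j}" by metis
      have K: "finite K" "K \<subseteq> J" using J by (auto simp: K_def)
      have out: "A j = UNIV" if "j \<in> J - K" for j using that by (auto simp: K_def)
      have "(\<forall>j\<in>J. Z j \<omega> \<in> A j) \<longleftrightarrow> (\<forall>j\<in>K. Z j \<omega> \<in> A j)" for \<omega>
        using out K(2) by blast
      moreover have "(\<forall>j\<in>K. Z j \<omega> \<in> A j) \<longleftrightarrow> (\<forall>j\<in>K. Z j \<omega> \<le> x j)" for \<omega>
        using x by simp
      ultimately have "(\<Inter>j\<in>J. Z j -` A j \<inter> space M) = {\<omega> \<in> space M. \<forall>j\<in>K. Z j \<omega> \<le> x j}"
        using J(1) by auto
      then have "prob ((\<Inter>j\<in>J. Z j -` A j \<inter> space M)) = (\<Prod>j\<in>K. prob {\<omega> \<in> space M. Z j \<omega> \<le> x j})"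
        using eq'[OF K(1)] by simp
      also have "\<dots> = (\<Prod>j\<in>K. prob (Z j -` A j \<inter> space M))"
        using x by (intro prod.cong refl arg_cong[where f=prob]) auto
      also have "\<dots> = (\<Prod>j\<in>J. prob (Z j -` A j \<inter> space M))"
        using out K J by (intro prod.mono_neutral_left) (auto simp: prob_space)
      finally show "prob ((\<Inter>j\<in>J. Z j -` A j \<inter> space M)) = (\<Prod>j\<in>J. prob (Z j -` A j \<inter> space M))" .
    qed
  qed (use J in auto)
  then have "indep_vars (\<lambda>_. borel) Z UNIV"
    unfolding indep_vars_def2 by (subst indep_sets_finite_index_sets) auto
  then show ?thesis
    using indep_vars_iff_distr_eq_PiM[where I=UNIV and M'="\<lambda>_. borel" and X=Z] by (simp add: law restrict_UNIV)
qed

lemma cts_step_tendsto: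
  "(\<lambda>m. cts_step a (a + inverse (real (Suc m))) z) \<longlonglongrightarrow> indicator {..a} z"
proof (cases "z \<le> a")
  case False
  have "\<forall>\<^sub>F m in sequentially. a + inverse (real (Suc m)) < z"
    using False by (intro order_tendstoD(2)[OF LIMSEQ_inverse_real_of_nat_add]) auto
  then have "\<forall>\<^sub>F m in sequentially. cts_step a (a + inverse (real (Suc m))) z = 0"
    by eventually_elim (use False in \<open>auto simp: cts_step_def\<close>)
  then show ?thesis using False by (auto intro: tendsto_eventually)
qed (simp add: cts_step_def)

text \<open>
  Products of continuous test functions determine the law of a sequence: they approximate
  indicators of half-lines from above, and half-lines form an intersection stable generator of the
  Borel sets. An even number of factors suffices since superfluous factors may be chosen constant.
\<close>

lemma (in prob_space) distr_eq_PiM_continuous: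
  fixes Z W :: "nat \<Rightarrow> 'a \<Rightarrow> real"
  assumes [measurable]: "\<And>j. Z j \<in> borel_measurable M" "\<And>j. W j \<in> borel_measurable M"
    and eq: "\<And>n (G :: nat \<Rightarrow> real \<Rightarrow> real). (\<And>j. continuous_on UNIV (G j)) \<Longrightarrow> (\<And>j z. 0 \<le> G j z) \<Longrightarrow> (\<And>j z. G j z \<le> 1) \<Longrightarrow>
      (\<integral>\<^sup>+\<omega>. (\<Prod>j<2 * n. ennreal (G j (Z j \<omega>))) \<partial>M) = (\<Prod>j<2 * n. \<integral>\<^sup>+\<omega>. ennreal (G j (W j \<omega>)) \<partial>M)"
  shows "distr M (PiM UNIV (\<lambda>_. borel)) (\<lambda>\<omega> j. Z j \<omega>) = PiM UNIV (\<lambda>j. distr M borel (W j))"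
proof (rule distr_eq_PiM_atMost)
  fix J :: "nat set" and x :: "nat \<Rightarrow> real" assume J: "finite J"
  then obtain n where n: "J \<subseteq> {..<2 * n}"
    by (metis finite_nat_bounded lessThan_subset_iff mult_2 le_add1 order_trans)
  define G where "G m j = (if j \<in> J then cts_step (x j) (x j + inverse (real (Suc m))) else (\<lambda>_. 1))" for m j
  have cont: "continuous_on UNIV (G m j)" for m j
    by (auto simp: G_def intro!: uniformly_continuous_imp_continuous cts_step_uniformly_continuous)
  have G01: "0 \<le> G m j z" "G m j z \<le> 1" for m j z
    by (auto simp: G_def cts_step_def)
  have [measurable]: "G m j \<in> borel_measurable borel" for m j
    by (rule borel_measurable_continuous_onI[OF cont])
  define I where "I j z = (if j \<in> J then indicator {..x j} z else 1 :: real)" for j z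
  have I0: "0 \<le> I j z" for j z by (simp add: I_def)
  have I: "(\<lambda>m. G m j z) \<longlonglongrightarrow> I j z" for j z
    using cts_step_tendsto[of "x j" z] by (auto simp: G_def I_def simp del: of_nat_Suc)
  have [measurable]: "I j \<in> borel_measurable borel" for j
    unfolding I_def by measurable
  have L1: "(\<lambda>m. \<integral>\<^sup>+\<omega>. (\<Prod>j<2 * n. ennreal (G m j (Z j \<omega>))) \<partial>M) \<longlonglongrightarrow> (\<integral>\<^sup>+\<omega>. (\<Prod>j<2 * n. ennreal (I j (Z j \<omega>))) \<partial>M)"
  proof (rule nn_integral_dominated_convergence[where w="\<lambda>_. 1"])
    show "\<And>m. AE \<omega> in M. (\<Prod>j<2 * n. ennreal (G m j (Z j \<omega>))) \<le> 1"
      using G01 by (auto intro!: prod_le_1)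
    show "AE \<omega> in M. (\<lambda>m. \<Prod>j<2 * n. ennreal (G m j (Z j \<omega>))) \<longlonglongrightarrow> (\<Prod>j<2 * n. ennreal (I j (Z j \<omega>)))"
      using G01 I0 by (subst (1 2) prod_ennreal) (auto intro!: tendsto_ennrealI tendsto_prod I)
  qed (auto simp: emeasure_space_1)
  have L2: "(\<lambda>m. \<integral>\<^sup>+\<omega>. ennreal (G m j (W j \<omega>)) \<partial>M) \<longlonglongrightarrow> (\<integral>\<^sup>+\<omega>. ennreal (I j (W j \<omega>)) \<partial>M)" for j
    by (rule nn_integral_dominated_convergence[where w="\<lambda>_. 1"])
      (auto intro!: tendsto_ennrealI I simp: emeasure_space_1 G01)
  have fin: "(\<integral>\<^sup>+\<omega>. ennreal (I j (W j \<omega>)) \<partial>M) \<noteq> \<top>" for j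
  proof -
    have "(\<integral>\<^sup>+\<omega>. ennreal (I j (W j \<omega>)) \<partial>M) \<le> (\<integral>\<^sup>+\<omega>. 1 \<partial>M)"
      by (intro nn_integral_mono) (auto simp: I_def indicator_def)
    then show ?thesis by (auto simp: emeasure_space_1 top_unique)
  qed
  have "(\<lambda>m. \<Prod>j<k. \<integral>\<^sup>+\<omega>. ennreal (G m j (W j \<omega>)) \<partial>M) \<longlonglongrightarrow> (\<Prod>j<k. \<integral>\<^sup>+\<omega>. ennreal (I j (W j \<omega>)) \<partial>M)" for k
  proof (induction k)
    case (Suc k)
    have "(\<Prod>j<k. \<integral>\<^sup>+\<omega>. ennreal (I j (W j \<omega>)) \<partial>M) \<noteq> \<top>"
      using fin by (simp add: ennreal_prod_eq_top)
    then show ?case using fin by (simp, intro tendsto_mult_ennreal Suc L2) auto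
  qed simp
  then have "(\<integral>\<^sup>+\<omega>. (\<Prod>j<2 * n. ennreal (I j (Z j \<omega>))) \<partial>M) = (\<Prod>j<2 * n. \<integral>\<^sup>+\<omega>. ennreal (I j (W j \<omega>)) \<partial>M)"
    using L1 unfolding eq[OF cont G01] by (blast intro: LIMSEQ_unique)
  also have "\<dots> = (\<Prod>j\<in>J. \<integral>\<^sup>+\<omega>. ennreal (I j (W j \<omega>)) \<partial>M)"
    using n by (intro prod.mono_neutral_right) (auto simp: I_def emeasure_space_1)
  also have "\<dots> = (\<Prod>j\<in>J. emeasure M {\<omega> \<in> space M. W j \<omega> \<le> x j})"
  proof (rule prod.cong[OF refl])
    fix j assume "j \<in> J"
    then have "(\<integral>\<^sup>+\<omega>. ennreal (I j (W j \<omega>)) \<partial>M) = (\<integral>\<^sup>+\<omega>. indicator {\<omega> \<in> space M. W j \<omega> \<le> x j} \<omega> \<partial>M)"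
      by (intro nn_integral_cong) (auto simp: I_def indicator_def)
    then show "(\<integral>\<^sup>+\<omega>. ennreal (I j (W j \<omega>)) \<partial>M) = emeasure M {\<omega> \<in> space M. W j \<omega> \<le> x j}" by simp
  qed
  also have "(\<integral>\<^sup>+\<omega>. (\<Prod>j<2 * n. ennreal (I j (Z j \<omega>))) \<partial>M) =
      (\<integral>\<^sup>+\<omega>. indicator {\<omega> \<in> space M. \<forall>j\<in>J. Z j \<omega> \<le> x j} \<omega> \<partial>M)"
  proof (intro nn_integral_cong)
    fix \<omega> assume "\<omega> \<in> space M"
    have "(\<Prod>j<2 * n. ennreal (I j (Z j \<omega>))) = (\<Prod>j\<in>J. ennreal (I j (Z j \<omega>)))"
      using n by (intro prod.mono_neutral_right) (auto simp: I_def)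
    also have "\<dots> = (\<Prod>j\<in>J. if Z j \<omega> \<le> x j then 1 else 0)"
      by (intro prod.cong) (auto simp: I_def indicator_def)
    also have "\<dots> = indicator {\<omega> \<in> space M. \<forall>j\<in>J. Z j \<omega> \<le> x j} \<omega>"
      using J \<open>\<omega> \<in> space M\<close> by (auto simp: indicator_def)
    finally show "(\<Prod>j<2 * n. ennreal (I j (Z j \<omega>))) = indicator {\<omega> \<in> space M. \<forall>j\<in>J. Z j \<omega> \<le> x j} \<omega>" .
  qed
  finally show "emeasure M {\<omega> \<in> space M. \<forall>j\<in>J. Z j \<omega> \<le> x j} = (\<Prod>j\<in>J. emeasure M {\<omega> \<in> space M. W j \<omega> \<le> x j})"
    using J by simp
qed measurable

section \<open>Independence of the path and the epochs\<close>

lemma (in prob_space) indep_elements_nn_integral: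
  assumes ind: "indep_elements M S Y S' Z"
    and F: "F \<in> borel_measurable (S \<Otimes>\<^sub>M S')"
  shows "(\<integral>\<^sup>+\<omega>. F (Y \<omega>, Z \<omega>) \<partial>M) = (\<integral>\<^sup>+\<omega>. \<integral>\<^sup>+\<omega>'. F (Y \<omega>', Z \<omega>) \<partial>M \<partial>M)"
proof -
  have Y [measurable]: "Y \<in> measurable M S" and Z [measurable]: "Z \<in> measurable M S'"
    using ind by (auto simp: indep_elements_def)
  interpret Y: prob_space "distr M S Y" by (rule prob_space_distr) simp
  interpret Z: prob_space "distr M S' Z" by (rule prob_space_distr) simp
  interpret YZ: pair_prob_space "distr M S Y" "distr M S' Z" ..
  have "distr M S Y \<Otimes>\<^sub>M distr M S' Z = distr M (S \<Otimes>\<^sub>M S') (\<lambda>\<omega>. (Y \<omega>, Z \<omega>))"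
  proof (rule pair_measure_eqI)
    show "sigma_finite_measure (distr M S Y)" "sigma_finite_measure (distr M S' Z)" by unfold_locales
    show "sets (distr M S Y \<Otimes>\<^sub>M distr M S' Z) = sets (distr M (S \<Otimes>\<^sub>M S') (\<lambda>\<omega>. (Y \<omega>, Z \<omega>)))"
      by (simp cong: sets_pair_measure_cong)
    fix A B assume "A \<in> sets (distr M S Y)" "B \<in> sets (distr M S' Z)"
    then have AB [measurable]: "A \<in> sets S" "B \<in> sets S'" by auto
    have "prob ((Y -` A \<inter> space M) \<inter> (Z -` B \<inter> space M)) = prob (Y -` A \<inter> space M) * prob (Z -` B \<inter> space M)"
      using ind AB unfolding indep_elements_def by (intro indep_setD) auto
    moreover have "(\<lambda>\<omega>. (Y \<omega>, Z \<omega>)) -` (A \<times> B) \<inter> space M = (Y -` A \<inter> space M) \<inter> (Z -` B \<inter> space M)"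
      by auto
    ultimately show "emeasure (distr M S Y) A * emeasure (distr M S' Z) B =
        emeasure (distr M (S \<Otimes>\<^sub>M S') (\<lambda>\<omega>. (Y \<omega>, Z \<omega>))) (A \<times> B)"
      by (simp add: emeasure_distr emeasure_eq_measure ennreal_mult)
  qed
  then have "(\<integral>\<^sup>+\<omega>. F (Y \<omega>, Z \<omega>) \<partial>M) = (\<integral>\<^sup>+p. F p \<partial>(distr M S Y \<Otimes>\<^sub>M distr M S' Z))"
    using F by (simp add: nn_integral_distr)
  also have "\<dots> = (\<integral>\<^sup>+z. \<integral>\<^sup>+y. F (y, z) \<partial>distr M S Y \<partial>distr M S' Z)"
    using F by (subst YZ.nn_integral_snd[symmetric]) (simp_all cong: measurable_cong_sets sets_pair_measure_cong)
  also have "\<dots> = (\<integral>\<^sup>+z. \<integral>\<^sup>+\<omega>'. F (Y \<omega>', z) \<partial>M \<partial>distr M S' Z)"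
    using F by (intro nn_integral_cong nn_integral_distr) simp_all
  also have "\<dots> = (\<integral>\<^sup>+\<omega>. \<integral>\<^sup>+\<omega>'. F (Y \<omega>', Z \<omega>) \<partial>M \<partial>M)"
  proof (rule nn_integral_distr[OF Z])
    have "(\<lambda>p. F (Y (snd p), fst p)) \<in> borel_measurable (S' \<Otimes>\<^sub>M M)"
      by (rule measurable_compose[OF _ F]) measurable
    then show "(\<lambda>z. \<integral>\<^sup>+\<omega>'. F (Y \<omega>', z) \<partial>M) \<in> borel_measurable (distr M S' Z)"
      using borel_measurable_nn_integral[of "\<lambda>z \<omega>'. F (Y \<omega>', z)" S'] by (simp add: split_beta')
  qed
  finally show ?thesis .
qed

lemma (in prob_space) indep_elements_compose:
  assumes ind: "indep_elements M S Y S' Z" and f: "f \<in> measurable S R"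
  shows "indep_elements M R (\<lambda>\<omega>. f (Y \<omega>)) S' Z"
proof -
  have Y: "Y \<in> measurable M S" using ind by (auto simp: indep_elements_def)
  have "{(\<lambda>\<omega>. f (Y \<omega>)) -` A \<inter> space M |A. A \<in> sets R} \<subseteq> {Y -` A \<inter> space M |A. A \<in> sets S}"
  proof safe
    fix A assume "A \<in> sets R"
    then show "\<exists>B. (\<lambda>\<omega>. f (Y \<omega>)) -` A \<inter> space M = Y -` B \<inter> space M \<and> B \<in> sets S"
      using measurable_sets[OF f, of A] measurable_space[OF Y]
      by (intro exI[of _ "f -` A \<inter> space S"]) auto
  qed
  then show ?thesis
    using ind measurable_compose[OF Y f]
    unfolding indep_elements_def indep_sets2_eq by (meson subsetD subset_trans)
qed

section \<open>Discretization of the blocks\<close>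

text \<open>
  A period of length \<open>t\<close> is rounded up to the next multiple of the mesh \<open>h\<close>, and one step is
  discounted. Rounding up keeps the discretized epochs to the right of the true ones, and for an
  exponential length the count is geometric on \<open>{0, 1, ...}\<close>.
\<close>

definition grid_count :: "real \<Rightarrow> real \<Rightarrow> nat" where
  "grid_count h t = nat (\<lceil>t / h\<rceil> - 1)"

lemma grid_count_bounds:
  assumes "0 < h" "0 < t"
  shows "t \<le> h * real (Suc (grid_count h t))" "h * real (Suc (grid_count h t)) \<le> t + h"
proof -
  have pos: "0 < \<lceil>t / h\<rceil>" using assms by simp
  then have eq: "real (Suc (grid_count h t)) = of_int \<lceil>t / h\<rceil>"
    unfolding grid_count_def by (simp add: of_nat_Suc)
  have "h * (t / h) \<le> h * of_int \<lceil>t / h\<rceil>" "h * of_int \<lceil>t / h\<rceil> \<le> h * (t / h + 1)"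
    by (rule mult_left_mono; use assms in linarith)+
  then show "t \<le> h * real (Suc (grid_count h t))" "h * real (Suc (grid_count h t)) \<le> t + h"
    unfolding eq using assms by (simp_all add: distrib_left)
qed

lemma grid_count_eq_iff:
  assumes "0 < h" "0 < t"
  shows "grid_count h t = n \<longleftrightarrow> h * real n < t \<and> t \<le> h * real (Suc n)"
proof -
  have pos: "0 < \<lceil>t / h\<rceil>" using assms by simp
  then have "grid_count h t = n \<longleftrightarrow> \<lceil>t / h\<rceil> = int n + 1"
    unfolding grid_count_def by linarith
  also have "\<dots> \<longleftrightarrow> real n < t / h \<and> t / h \<le> real n + 1"
    by (auto simp: ceiling_eq_iff)
  also have "\<dots> \<longleftrightarrow> h * real n < t \<and> t \<le> h * real (Suc n)"
    using assms by (simp add: field_simps)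
  finally show ?thesis .
qed

lemma measurable_grid_count [measurable]: "grid_count h \<in> measurable borel (count_space UNIV)"
  unfolding grid_count_def by measurable

definition grid_counts :: "real \<Rightarrow> (nat \<Rightarrow> real) \<Rightarrow> nat \<Rightarrow> nat" where
  "grid_counts h t i = grid_count h (t (Suc i) - t i)"

definition grid_steps :: "real \<Rightarrow> (real \<Rightarrow> real) \<Rightarrow> nat \<Rightarrow> real" where
  "grid_steps h x j = x (h * real (Suc j)) - x (h * real j)"

definition grid_block :: "real \<Rightarrow> (nat \<Rightarrow> real) \<Rightarrow> (real \<Rightarrow> real) \<Rightarrow> nat \<Rightarrow> nat \<Rightarrow> real" where
  "grid_block h t x i = shift (Suc (block_start (grid_counts h t) i)) (grid_steps h x)"

lemma walk_grid_steps: "walk (grid_steps h x) k = x (h * real k) - x 0"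
  by (induction k) (simp_all add: walk_def grid_steps_def)

lemma walk_grid_block:
  "walk (grid_block h t x i) k =
     x (h * real (Suc (block_start (grid_counts h t) i)) + h * real k) - x (h * real (Suc (block_start (grid_counts h t) i)))"
  by (simp add: grid_block_def walk_shift walk_grid_steps algebra_simps)

lemma measurable_block_start:
  assumes [measurable]: "\<And>i. (\<lambda>z. \<kappa> z i) \<in> measurable N (count_space UNIV)"
  shows "(\<lambda>z. block_start (\<kappa> z) i) \<in> measurable N (count_space UNIV)"
proof (induction i)
  case (Suc i)
  have "(\<lambda>z. Suc (k + \<kappa> z i)) \<in> measurable N (count_space UNIV)" for k
    by (rule measurable_compose[OF assms]) simp
  then have "(\<lambda>z. Suc (block_start (\<kappa> z) i + \<kappa> z i)) \<in> measurable N (count_space UNIV)"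
    using Suc by (rule measurable_compose_countable)
  then show ?case by (simp add: block_start_Suc)
qed (simp add: block_start_def)

text \<open>
  Evaluating a path at a random time is not a measurable operation on the product space of all
  paths. On a grid only countably many evaluations occur, and the functional becomes jointly
  measurable in path and epochs; this is what makes Fubini's theorem applicable before the passage to
  the limit.
\<close>

lemma measurable_grid_functional:
  fixes \<psi> :: "nat \<Rightarrow> (nat \<Rightarrow> real) \<Rightarrow> 'b::topological_space"
  assumes \<psi>: "\<And>k. \<psi> k \<in> borel_measurable (PiM UNIV (\<lambda>_. borel))"
    and x: "\<And>s. 0 \<le> s \<Longrightarrow> (\<lambda>z. x z s) \<in> borel_measurable N"
    and t [measurable]: "\<And>i. (\<lambda>z. t z i) \<in> borel_measurable N"
    and h: "0 < h"
  shows "(\<lambda>z. \<psi> (grid_counts h (t z) i) (grid_block h (t z) (x z) i)) \<in> borel_measurable N"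
proof -
  have counts [measurable]: "(\<lambda>z. grid_counts h (t z) i) \<in> measurable N (count_space UNIV)" for i
    unfolding grid_counts_def by measurable
  have steps: "(\<lambda>z. grid_steps h (x z)) \<in> measurable N (PiM UNIV (\<lambda>_. borel))"
    unfolding grid_steps_def using h by (intro measurable_abs_UNIV borel_measurable_diff x) simp_all
  have "(\<lambda>z. \<psi> k (shift m (grid_steps h (x z)))) \<in> borel_measurable N" for k m
    by (rule measurable_compose[OF measurable_shift[OF steps] \<psi>])
  then have "(\<lambda>z. \<psi> k (shift (Suc (block_start (grid_counts h (t z)) i)) (grid_steps h (x z)))) \<in> borel_measurable N" for k
    using measurable_compose_countable[of "\<lambda>m z. \<psi> k (shift (Suc m) (grid_steps h (x z)))" N borel
        "\<lambda>z. block_start (grid_counts h (t z)) i"] measurable_block_start[OF counts] by simp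
  then show ?thesis
    unfolding grid_block_def
    using measurable_compose_countable[of "\<lambda>k z. \<psi> k (shift (Suc (block_start (grid_counts h (t z)) i)) (grid_steps h (x z)))" N borel
        "\<lambda>z. grid_counts h (t z) i"] by simp
qed

context
  fixes t :: "nat \<Rightarrow> real" and h :: "nat \<Rightarrow> real"
  assumes t: "t 0 = 0" "strict_mono t" and h: "h \<longlonglongrightarrow> 0" "\<And>n. 0 < h n"
begin

lemma block_start_bounds:
  "t i \<le> h n * real (block_start (grid_counts (h n) t) i)"
  "h n * real (block_start (grid_counts (h n) t) i) \<le> t i + real i * h n"
proof (induction i)
  case (Suc i)
  have inc: "0 < t (Suc i) - t i" using t(2) by (simp add: strict_mono_Suc_iff)
  have "h n * real (block_start (grid_counts (h n) t) (Suc i)) =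
      h n * real (block_start (grid_counts (h n) t) i) + h n * real (Suc (grid_count (h n) (t (Suc i) - t i)))"
    by (simp add: block_start_Suc grid_counts_def algebra_simps)
  with Suc grid_count_bounds[OF h(2)[of n] inc]
  show "t (Suc i) \<le> h n * real (block_start (grid_counts (h n) t) (Suc i))"
    "h n * real (block_start (grid_counts (h n) t) (Suc i)) \<le> t (Suc i) + real (Suc i) * h n"
    by (simp_all add: algebra_simps)
qed (simp_all add: t block_start_def)

lemma block_start_tendsto: "(\<lambda>n. h n * real (block_start (grid_counts (h n) t) i)) \<longlonglongrightarrow> t i"
proof (rule tendsto_sandwich[of "\<lambda>_. t i" _ _ "\<lambda>n. t i + real i * h n"])
  have "(\<lambda>n. t i + real i * h n) \<longlonglongrightarrow> t i + real i * 0" by (intro tendsto_intros h)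
  then show "(\<lambda>n. t i + real i * h n) \<longlonglongrightarrow> t i" by simp
qed (use block_start_bounds in auto)

context
  fixes x :: "real \<Rightarrow> real" and i :: nat
  assumes x: "cadlag x"
begin

lemma grid_block_first_tendsto:
  "(\<lambda>n. h n * real (Suc (block_start (grid_counts (h n) t) i))) \<longlonglongrightarrow> t i"
  "t i \<le> h n * real (Suc (block_start (grid_counts (h n) t) i))"
proof -
  have "(\<lambda>n. h n * real (block_start (grid_counts (h n) t) i) + h n) \<longlonglongrightarrow> t i + 0"
    by (intro tendsto_intros h block_start_tendsto)
  then show "(\<lambda>n. h n * real (Suc (block_start (grid_counts (h n) t) i))) \<longlonglongrightarrow> t i"
    by (simp add: algebra_simps)
  show "t i \<le> h n * real (Suc (block_start (grid_counts (h n) t) i))"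
    using block_start_bounds(1)[of i n] h(2)[of n] by (simp add: algebra_simps)
qed

lemma grid_block_last_eq:
  "h n * real (Suc (block_start (grid_counts (h n) t) i)) + h n * real (grid_counts (h n) t i) =
     h n * real (block_start (grid_counts (h n) t) (Suc i))"
  by (simp add: block_start_Suc algebra_simps)

lemmas grid_block_limits =
  x epochs_nonneg[OF t, of i] strict_mono_leD[OF t(2), of i "Suc i"] h grid_block_first_tendsto
  block_start_tendsto[of "Suc i"] block_start_bounds(1)[of "Suc i"]

lemma path_at_first_tendsto:
  "(\<lambda>n. x (h n * real (Suc (block_start (grid_counts (h n) t) i)))) \<longlonglongrightarrow> x (t i)"
  by (rule cadlag_right_tendsto[OF x epochs_nonneg[OF t] grid_block_first_tendsto])

lemma walk_min_block_tendsto: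
  "(\<lambda>n. walk_min (grid_block (h n) t x i) (grid_counts (h n) t i)) \<longlonglongrightarrow> block_inf t x i - x (t i)"
proof -
  let ?s = "\<lambda>n. h n * real (Suc (block_start (grid_counts (h n) t) i))"
  have "(\<lambda>n. Min ((\<lambda>k. x (?s n + h n * real k)) ` {..grid_counts (h n) t i})) \<longlonglongrightarrow> block_inf t x i"
    unfolding block_inf_def
    by (rule grid_min_tendsto; (simp only: grid_block_last_eq)?) (use grid_block_limits in auto)
  moreover have "walk_min (grid_block (h n) t x i) (grid_counts (h n) t i) =
      Min ((\<lambda>k. x (?s n + h n * real k)) ` {..grid_counts (h n) t i}) - x (?s n)" for n
    unfolding walk_min_def walk_grid_block
    using Min_add_commute[of "{..grid_counts (h n) t i}" "\<lambda>k. x (?s n + h n * real k)" "- x (?s n)"] by simp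
  ultimately show ?thesis using path_at_first_tendsto by (simp add: tendsto_diff)
qed

lemma walk_max_block_tendsto:
  "(\<lambda>n. walk_max (grid_block (h n) t x i) (grid_counts (h n) t i)) \<longlonglongrightarrow> block_sup t x i - x (t i)"
proof -
  let ?s = "\<lambda>n. h n * real (Suc (block_start (grid_counts (h n) t) i))"
  have "(\<lambda>n. Max ((\<lambda>k. x (?s n + h n * real k)) ` {..grid_counts (h n) t i})) \<longlonglongrightarrow> block_sup t x i"
    unfolding block_sup_def
    by (rule grid_max_tendsto; (simp only: grid_block_last_eq)?) (use grid_block_limits in auto)
  moreover have "walk_max (grid_block (h n) t x i) (grid_counts (h n) t i) =
      Max ((\<lambda>k. x (?s n + h n * real k)) ` {..grid_counts (h n) t i}) - x (?s n)" for n
    unfolding walk_max_def walk_grid_block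
    using Max_add_commute[of "{..grid_counts (h n) t i}" "\<lambda>k. x (?s n + h n * real k)" "- x (?s n)"] by simp
  ultimately show ?thesis using path_at_first_tendsto by (simp add: tendsto_diff)
qed

lemma walk_block_tendsto:
  "(\<lambda>n. walk (grid_block (h n) t x i) (grid_counts (h n) t i)) \<longlonglongrightarrow> x (t (Suc i)) - x (t i)"
  unfolding walk_grid_block grid_block_last_eq
  by (intro tendsto_diff path_at_first_tendsto
      cadlag_right_tendsto[OF x epochs_nonneg[OF t] block_start_tendsto block_start_bounds(1)])

end

end

section \<open>Block extrema of a Levy process\<close>

locale levy_poisson = prob_space M
  for M :: "'w measure" and X :: "real \<Rightarrow> 'w \<Rightarrow> real" and T :: "nat \<Rightarrow> 'w \<Rightarrow> real" and lam :: real +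
  assumes levy: "levy_process M X"
    and lam: "0 < lam"
    and epochs: "poisson_epochs M lam T"
    and indep_X_T: "indep_elements M path_space (path_of X) epoch_space (\<lambda>\<omega> i. T i \<omega>)"
begin

lemma X_measurable: "0 \<le> t \<Longrightarrow> X t \<in> borel_measurable M"
  using levy by (simp add: levy_process_def)

lemma X_cadlag: "\<omega> \<in> space M \<Longrightarrow> cadlag (\<lambda>t. X t \<omega>)"
  using levy by (simp add: levy_process_def)

lemma T_measurable [measurable]: "T i \<in> borel_measurable M"
proof -
  have "(\<lambda>\<omega> i. T i \<omega>) \<in> measurable M (PiM UNIV (\<lambda>_. borel))"
    using indep_X_T by (simp add: indep_elements_def)
  from measurable_compose[OF this measurable_component_singleton[of i]] show ?thesis by simp
qed

lemma T_0: "\<omega> \<in> space M \<Longrightarrow> T 0 \<omega> = 0"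
  and T_strict_mono: "\<omega> \<in> space M \<Longrightarrow> strict_mono (\<lambda>i. T i \<omega>)"
  using epochs by (simp_all add: poisson_epochs_def)

lemma T_increment_pos: "\<omega> \<in> space M \<Longrightarrow> 0 < T (Suc i) \<omega> - T i \<omega>"
  using T_strict_mono by (simp add: strict_mono_Suc_iff)

lemma T_increment_gt:
  assumes "0 \<le> s"
  shows "prob {\<omega> \<in> space M. s < T (Suc i) \<omega> - T i \<omega>} = exp (- s * lam)"
  using epochs by (intro exponential_distributedD_gt[OF _ assms lam]) (simp add: poisson_epochs_def)

lemma T_increments_indep: "indep_vars (\<lambda>_. borel) (\<lambda>i \<omega>. T (Suc i) \<omega> - T i \<omega>) UNIV"
  using epochs by (simp add: poisson_epochs_def)

text \<open>
  If the epochs stay below \<open>c\<close>, all of the independent waiting times are at most \<open>c\<close>.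
\<close>

lemma T_unbounded: "AE \<omega> in M. \<forall>c. \<exists>n. c < T n \<omega>"
proof -
  have "AE \<omega> in M. \<exists>n. real c < T n \<omega>" for c :: nat
  proof (rule AE_I')
    define N where "N = {\<omega> \<in> space M. \<forall>n. T n \<omega> \<le> real c}"
    have [measurable]: "N \<in> sets M" unfolding N_def by measurable
    define q where "q = 1 - exp (- real c * lam)"
    have q: "0 \<le> q" "q < 1" using lam by (auto simp: q_def)
    have inc: "prob ((\<lambda>\<omega>. T (Suc i) \<omega> - T i \<omega>) -` {..real c} \<inter> space M) = q" for i
    proof -
      have "(\<lambda>\<omega>. T (Suc i) \<omega> - T i \<omega>) -` {..real c} \<inter> space M =
          space M - {\<omega> \<in> space M. real c < T (Suc i) \<omega> - T i \<omega>}" by auto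
      then show ?thesis using T_increment_gt[of "real c" i] by (simp add: prob_compl q_def)
    qed
    have "prob N \<le> q ^ Suc n" for n
    proof -
      have "N \<subseteq> (\<Inter>i\<in>{..n}. (\<lambda>\<omega>. T (Suc i) \<omega> - T i \<omega>) -` {..real c} \<inter> space M)"
      proof
        fix \<omega> assume "\<omega> \<in> N"
        then have \<omega>: "\<omega> \<in> space M" and le: "\<And>n. T n \<omega> \<le> real c" by (auto simp: N_def)
        have "T (Suc i) \<omega> - T i \<omega> \<le> real c" for i
          using le[of "Suc i"] epochs_nonneg[of "\<lambda>i. T i \<omega>" i] T_0[OF \<omega>] T_strict_mono[OF \<omega>] by simp
        with \<omega> show "\<omega> \<in> (\<Inter>i\<in>{..n}. (\<lambda>\<omega>. T (Suc i) \<omega> - T i \<omega>) -` {..real c} \<inter> space M)" by auto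
      qed
      then have "prob N \<le> prob (\<Inter>i\<in>{..n}. (\<lambda>\<omega>. T (Suc i) \<omega> - T i \<omega>) -` {..real c} \<inter> space M)"
        by (intro finite_measure_mono sets.finite_INT) auto
      also have "\<dots> = (\<Prod>i\<in>{..n}. prob ((\<lambda>\<omega>. T (Suc i) \<omega> - T i \<omega>) -` {..real c} \<inter> space M))"
        by (rule indep_varsD[OF T_increments_indep]) auto
      also have "\<dots> = (\<Prod>i\<in>{..n}. q)" unfolding inc ..
      finally show ?thesis by simp
    qed
    moreover have "(\<lambda>n. q ^ Suc n) \<longlonglongrightarrow> 0"
      using q by (intro LIMSEQ_Suc LIMSEQ_realpow_zero) auto
    ultimately have "prob N \<le> 0" by (intro LIMSEQ_le_const[of _ 0]) auto
    then show "N \<in> null_sets M" by (auto intro!: null_setsI simp: emeasure_eq_measure measure_le_0_iff)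
    show "{\<omega> \<in> space M. \<not> (\<exists>n. real c < T n \<omega>)} \<subseteq> N" by (auto simp: N_def not_less)
  qed
  then have "AE \<omega> in M. \<forall>c::nat. \<exists>n. real c < T n \<omega>" by (subst AE_all_countable) auto
  then show ?thesis
    by eventually_elim (meson order.strict_trans1 reals_Archimedean2 less_imp_le)
qed

lemma grid_steps_law:
  assumes h: "0 < h"
  shows "distr M (PiM UNIV (\<lambda>_. borel)) (\<lambda>\<omega>. grid_steps h (\<lambda>t. X t \<omega>)) = PiM UNIV (\<lambda>_. distr M borel (X h))"
proof -
  let ?\<xi> = "\<lambda>j \<omega>. X (h * real (Suc j)) \<omega> - X (h * real j) \<omega>"
  have meas [measurable]: "?\<xi> j \<in> borel_measurable M" for j
    using h by (intro borel_measurable_diff X_measurable) simp_all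
  have ind: "indep_vars (\<lambda>_. borel) ?\<xi> {..<n}" for n
  proof -
    have mono: "mono_on {..n} (\<lambda>j. h * real j)" using h by (simp add: mono_on_def)
    have "indep_vars (\<lambda>_. borel) (\<lambda>i \<omega>. X (t (Suc i)) \<omega> - X (t i) \<omega>) {..<n}"
      if "0 \<le> t 0" "mono_on {..n} t" for t :: "nat \<Rightarrow> real"
      using levy that by (simp add: levy_process_def)
    from this[of "\<lambda>j. h * real j"] show ?thesis using mono by simp
  qed
  have "indep_vars (\<lambda>_. borel) ?\<xi> UNIV"
    unfolding indep_vars_def2
  proof (intro conjI ballI meas, subst indep_sets_finite_index_sets, intro allI impI)
    fix J :: "nat set" assume "finite J"
    then obtain n where "J \<subseteq> {..<n}" by (metis finite_nat_iff_bounded)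
    then show "indep_sets (\<lambda>i. {?\<xi> i -` A \<inter> space M |A. A \<in> sets borel}) J"
      using ind[of n] unfolding indep_vars_def2 by (auto intro: indep_sets_mono_index)
  qed
  then have "distr M (PiM UNIV (\<lambda>_. borel)) (\<lambda>\<omega> j. ?\<xi> j \<omega>) = PiM UNIV (\<lambda>j. distr M borel (?\<xi> j))"
    using indep_vars_iff_distr_eq_PiM[where I=UNIV and M'="\<lambda>_. borel" and X="?\<xi>"] meas
    by (simp add: restrict_UNIV del: of_nat_Suc)
  moreover have "distr M borel (?\<xi> j) = distr M borel (X h)" for j
  proof -
    have "h * real (Suc j) = h * real j + h" by (simp add: algebra_simps)
    then show ?thesis using levy h unfolding levy_process_def by simp
  qed
  ultimately show ?thesis by (simp add: grid_steps_def[abs_def] del: of_nat_Suc)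
qed

lemma nn_integral_grid_count:
  fixes e :: "nat \<Rightarrow> ennreal"
  assumes h: "0 < h"
  shows "(\<integral>\<^sup>+\<omega>. e (grid_count h (T (Suc i) \<omega> - T i \<omega>)) \<partial>M) =
    (\<Sum>k. ennreal (1 - exp (- h * lam)) * ennreal (exp (- h * lam)) ^ k * e k)"
proof -
  let ?\<tau> = "\<lambda>\<omega>. T (Suc i) \<omega> - T i \<omega>"
  define A where "A k = {\<omega> \<in> space M. grid_count h (?\<tau> \<omega>) = k}" for k
  define B where "B k = {\<omega> \<in> space M. h * real k < ?\<tau> \<omega>}" for k
  have [measurable]: "A k \<in> sets M" "B k \<in> sets M" for k unfolding A_def B_def by measurable
  have "grid_count h (?\<tau> \<omega>) = k \<longleftrightarrow> h * real k < ?\<tau> \<omega> \<and> \<not> h * real (Suc k) < ?\<tau> \<omega>"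
    if "\<omega> \<in> space M" for \<omega> k
    using grid_count_eq_iff[OF h T_increment_pos[OF that]] by (simp only: not_less)
  then have "A k = B k - B (Suc k)" for k
    unfolding A_def B_def by blast
  moreover have "B (Suc k) \<subseteq> B k" for k
    using h by (auto simp: B_def intro: le_less_trans[rotated])
  moreover have "prob (B k) = exp (- h * lam) ^ k" for k
    using T_increment_gt[of "h * real k" i] h by (simp add: B_def exp_of_nat_mult[symmetric] mult_ac)
  ultimately have "prob (A k) = (1 - exp (- h * lam)) * exp (- h * lam) ^ k" for k
    by (simp add: finite_measure_Diff algebra_simps)
  then have A: "emeasure M (A k) = ennreal (1 - exp (- h * lam)) * ennreal (exp (- h * lam)) ^ k" for k
    using h lam by (simp add: emeasure_eq_measure ennreal_mult ennreal_power)
  have "(\<integral>\<^sup>+\<omega>. e (grid_count h (?\<tau> \<omega>)) \<partial>M) = (\<integral>\<^sup>+\<omega>. (\<Sum>k. e k * indicator (A k) \<omega>) \<partial>M)"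
  proof (intro nn_integral_cong)
    fix \<omega> assume "\<omega> \<in> space M"
    then show "e (grid_count h (?\<tau> \<omega>)) = (\<Sum>k. e k * indicator (A k) \<omega>)"
      by (subst suminf_finite[of "{grid_count h (?\<tau> \<omega>)}"]) (auto simp: A_def)
  qed
  also have "\<dots> = (\<Sum>k. e k * emeasure M (A k))"
    by (subst nn_integral_suminf) (simp_all add: nn_integral_cmult_indicator)
  finally show ?thesis by (simp add: A mult_ac)
qed

text \<open>
  Conditionally on the epochs the blocks consist of prescribed, disjoint stretches of independent
  identically distributed steps; integrating over the epochs, the independence of the waiting times
  factorizes the result further.
\<close>

lemma nn_integral_grid_blocks:
  fixes \<psi> :: "nat \<Rightarrow> nat \<Rightarrow> (nat \<Rightarrow> real) \<Rightarrow> ennreal"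
  assumes h: "0 < h"
    and \<psi> [measurable]: "\<And>i k. \<psi> i k \<in> borel_measurable (PiM UNIV (\<lambda>_. borel))"
    and local: "\<And>i k x y. (\<And>j. j < k \<Longrightarrow> x j = y j) \<Longrightarrow> \<psi> i k x = \<psi> i k y"
  shows "(\<integral>\<^sup>+\<omega>. (\<Prod>i<n. \<psi> i (grid_counts h (\<lambda>i. T i \<omega>) i) (grid_block h (\<lambda>i. T i \<omega>) (\<lambda>t. X t \<omega>) i)) \<partial>M) =
    (\<Prod>i<n. \<Sum>k. ennreal (1 - exp (- h * lam)) * ennreal (exp (- h * lam)) ^ k *
       (\<integral>\<^sup>+x. \<psi> i k x \<partial>(PiM UNIV (\<lambda>_. distr M borel (X h)))))"
proof -
  define F where "F z = (\<Prod>i<n. \<psi> i (grid_counts h (snd z) i) (grid_block h (snd z) (fst z) i))"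
    for z :: "(real \<Rightarrow> real) \<times> (nat \<Rightarrow> real)"
  have Xh [measurable]: "X h \<in> borel_measurable M" using h by (intro X_measurable) simp
  interpret \<xi>: iid_steps "distr M borel (X h)"
    by (intro iid_steps.intro sequence_space.intro product_prob_spaceI prob_space_distr Xh) (simp add: iid_steps_axioms_def)
  have F: "F \<in> borel_measurable (path_space \<Otimes>\<^sub>M epoch_space)"
    unfolding F_def
  proof (intro borel_measurable_prod_ennreal measurable_grid_functional h \<psi>)
    fix s :: real assume "0 \<le> s"
    then show "(\<lambda>z. fst z s) \<in> borel_measurable (path_space \<Otimes>\<^sub>M epoch_space)"
      by (intro measurable_compose[OF measurable_fst measurable_component_singleton]) simp
  next
    show "(\<lambda>z. snd z i) \<in> borel_measurable (path_space \<Otimes>\<^sub>M epoch_space)" for i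
      by (intro measurable_compose[OF measurable_snd measurable_component_singleton]) simp
  qed
  have path: "grid_block h t (path_of X \<omega>) i = grid_block h t (\<lambda>t. X t \<omega>) i" for t i \<omega>
  proof -
    have "grid_steps h (path_of X \<omega>) = grid_steps h (\<lambda>t. X t \<omega>)"
      using h by (simp add: grid_steps_def path_of_def fun_eq_iff)
    then show ?thesis by (simp add: grid_block_def)
  qed
  have steps [measurable]: "(\<lambda>\<omega>. grid_steps h (\<lambda>t. X t \<omega>)) \<in> measurable M (PiM UNIV (\<lambda>_. borel))"
    unfolding grid_steps_def using h by (intro measurable_abs_UNIV borel_measurable_diff X_measurable) simp_all
  have fixed: "(\<integral>\<^sup>+\<omega>. (\<Prod>i<n. \<psi> i (grid_counts h t i) (grid_block h t (\<lambda>t. X t \<omega>) i)) \<partial>M) =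
      (\<Prod>i<n. \<integral>\<^sup>+x. \<psi> i (grid_counts h t i) x \<partial>\<xi>.S)" for t
  proof -
    have m: "(\<lambda>x. \<Prod>i<n. \<psi> i (grid_counts h t i) (shift (Suc (block_start (grid_counts h t) i)) x)) \<in>
        borel_measurable (PiM UNIV (\<lambda>_. borel))"
      by (intro borel_measurable_prod_ennreal measurable_compose[OF measurable_shift \<psi>]) simp
    have "(\<integral>\<^sup>+\<omega>. (\<Prod>i<n. \<psi> i (grid_counts h t i) (grid_block h t (\<lambda>t. X t \<omega>) i)) \<partial>M) =
        (\<integral>\<^sup>+x. (\<Prod>i<n. \<psi> i (grid_counts h t i) (shift (Suc (block_start (grid_counts h t) i)) x))
          \<partial>distr M (PiM UNIV (\<lambda>_. borel)) (\<lambda>\<omega>. grid_steps h (\<lambda>t. X t \<omega>)))"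
      using m by (subst nn_integral_distr[OF steps]) (simp_all add: grid_block_def)
    also have "\<dots> = (\<Prod>i<n. \<integral>\<^sup>+x. \<psi> i (grid_counts h t i) x \<partial>\<xi>.S)"
      unfolding grid_steps_law[OF h]
      by (rule \<xi>.nn_integral_blocks) (auto intro: local simp: measurable_cong_sets[OF \<xi>.sets_S refl])
    finally show ?thesis .
  qed
  have "(\<integral>\<^sup>+\<omega>. (\<Prod>i<n. \<psi> i (grid_counts h (\<lambda>i. T i \<omega>) i) (grid_block h (\<lambda>i. T i \<omega>) (\<lambda>t. X t \<omega>) i)) \<partial>M) =
      (\<integral>\<^sup>+\<omega>. F (path_of X \<omega>, \<lambda>i. T i \<omega>) \<partial>M)"
    by (simp add: F_def path)
  also have "\<dots> = (\<integral>\<^sup>+\<omega>. \<integral>\<^sup>+\<omega>'. F (path_of X \<omega>', \<lambda>i. T i \<omega>) \<partial>M \<partial>M)"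
    by (rule indep_elements_nn_integral[OF indep_X_T F])
  also have "\<dots> = (\<integral>\<^sup>+\<omega>. (\<Prod>i<n. \<integral>\<^sup>+x. \<psi> i (grid_count h (T (Suc i) \<omega> - T i \<omega>)) x \<partial>\<xi>.S) \<partial>M)"
    by (simp only: F_def fst_conv snd_conv path fixed) (simp add: grid_counts_def)
  also have "\<dots> = (\<Prod>i<n. \<integral>\<^sup>+\<omega>. (\<integral>\<^sup>+x. \<psi> i (grid_count h (T (Suc i) \<omega> - T i \<omega>)) x \<partial>\<xi>.S) \<partial>M)"
  proof (rule indep_vars_nn_integral)
    have "indep_vars (\<lambda>_. borel) (\<lambda>i \<omega>. T (Suc i) \<omega> - T i \<omega>) {..<n}"
      by (rule indep_vars_subset[OF T_increments_indep]) simp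
    then show "indep_vars (\<lambda>_. borel) (\<lambda>i \<omega>. \<integral>\<^sup>+x. \<psi> i (grid_count h (T (Suc i) \<omega> - T i \<omega>)) x \<partial>\<xi>.S) {..<n}"
    proof (rule indep_vars_compose2)
      show "(\<lambda>\<tau>. \<integral>\<^sup>+x. \<psi> i (grid_count h \<tau>) x \<partial>\<xi>.S) \<in> borel_measurable borel" for i
        by (rule measurable_compose[OF measurable_grid_count]) simp
    qed
  qed simp_all
  also have "\<dots> = (\<Prod>i<n. \<Sum>k. ennreal (1 - exp (- h * lam)) * ennreal (exp (- h * lam)) ^ k * (\<integral>\<^sup>+x. \<psi> i k x \<partial>\<xi>.S))"
    by (intro prod.cong refl nn_integral_grid_count[OF h, where e="\<lambda>k. \<integral>\<^sup>+x. \<psi> _ k x \<partial>\<xi>.S"])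
  finally show ?thesis .
qed

text \<open>
  Discrete form of the independence of the drops to the block minima and the subsequent rises. The
  right-hand side is expressed by the first block alone, in a form that has an evident limit as the
  mesh tends to 0.
\<close>

lemma grid_factorization:
  fixes G H :: "nat \<Rightarrow> real \<Rightarrow> ennreal"
  assumes h: "0 < h"
    and [measurable]: "\<And>i. G i \<in> borel_measurable borel" "\<And>i. H i \<in> borel_measurable borel"
  defines "\<kappa> \<equiv> \<lambda>\<omega> i. grid_counts h (\<lambda>i. T i \<omega>) i"
    and "b \<equiv> \<lambda>\<omega> i. grid_block h (\<lambda>i. T i \<omega>) (\<lambda>t. X t \<omega>) i"
  shows "(\<integral>\<^sup>+\<omega>. (\<Prod>i<n. G i (walk_min (b \<omega> i) (\<kappa> \<omega> i)) *
        H i (walk (b \<omega> i) (\<kappa> \<omega> i) - walk_min (b \<omega> i) (\<kappa> \<omega> i))) \<partial>M) =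
    (\<Prod>i<n. (\<integral>\<^sup>+\<omega>. G i (walk_min (b \<omega> 0) (\<kappa> \<omega> 0)) \<partial>M) * (\<integral>\<^sup>+\<omega>. H i (walk_max (b \<omega> 0) (\<kappa> \<omega> 0)) \<partial>M))"
proof -
  have Xh [measurable]: "X h \<in> borel_measurable M" using h by (intro X_measurable) simp
  interpret \<xi>: iid_steps "distr M borel (X h)"
    by (intro iid_steps.intro sequence_space.intro product_prob_spaceI prob_space_distr Xh) (simp add: iid_steps_axioms_def)
  let ?c = "ennreal (1 - exp (- h * lam))" and ?p = "ennreal (exp (- h * lam))"
  have q: "(\<Sum>k. ?c * ?p ^ k) = 1"
    using nn_integral_grid_count[OF h, of "\<lambda>_. 1" 0] by (simp add: emeasure_space_1)
  have walk_eq: "walk x l = walk y l" if "\<And>j. j < k \<Longrightarrow> x j = y j" "l \<le> k" for x y k l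
    using that by (intro walk_cong) auto
  have min_eq: "walk_min x k = walk_min y k" and max_eq: "walk_max x k = walk_max y k"
    if "\<And>j. j < k \<Longrightarrow> x j = y j" for x y k
  proof -
    have "walk x ` {..k} = walk y ` {..k}" using walk_eq[of k x y] that by (intro image_cong) auto
    then show "walk_min x k = walk_min y k" "walk_max x k = walk_max y k"
      by (simp_all add: walk_min_def walk_max_def)
  qed
  have 1: "(\<integral>\<^sup>+\<omega>. g (walk_min (b \<omega> 0) (\<kappa> \<omega> 0)) \<partial>M) = (\<Sum>k. ?c * ?p ^ k * (\<integral>\<^sup>+x. g (walk_min x k) \<partial>\<xi>.S))"
    if [measurable]: "g \<in> borel_measurable borel" for g :: "real \<Rightarrow> ennreal"
  proof -
    have loc: "g (walk_min x k) = g (walk_min y k)" if "\<And>j. j < k \<Longrightarrow> x j = y j" for k x y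
      by (rule arg_cong[OF min_eq[OF that]])
    have m: "(\<lambda>x. g (walk_min x k)) \<in> borel_measurable (PiM UNIV (\<lambda>_. borel))" for k
      by measurable
    show ?thesis
      using nn_integral_grid_blocks[OF h, of "\<lambda>_ k x. g (walk_min x k)" 1, OF m loc]
      by (simp add: b_def \<kappa>_def)
  qed
  have 2: "(\<integral>\<^sup>+\<omega>. g (walk_max (b \<omega> 0) (\<kappa> \<omega> 0)) \<partial>M) = (\<Sum>k. ?c * ?p ^ k * (\<integral>\<^sup>+x. g (walk_max x k) \<partial>\<xi>.S))"
    if [measurable]: "g \<in> borel_measurable borel" for g :: "real \<Rightarrow> ennreal"
  proof -
    have loc: "g (walk_max x k) = g (walk_max y k)" if "\<And>j. j < k \<Longrightarrow> x j = y j" for k x y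
      by (rule arg_cong[OF max_eq[OF that]])
    have m: "(\<lambda>x. g (walk_max x k)) \<in> borel_measurable (PiM UNIV (\<lambda>_. borel))" for k
      by measurable
    show ?thesis
      using nn_integral_grid_blocks[OF h, of "\<lambda>_ k x. g (walk_max x k)" 1, OF m loc]
      by (simp add: b_def \<kappa>_def)
  qed
  have "(\<integral>\<^sup>+\<omega>. (\<Prod>i<n. G i (walk_min (b \<omega> i) (\<kappa> \<omega> i)) *
        H i (walk (b \<omega> i) (\<kappa> \<omega> i) - walk_min (b \<omega> i) (\<kappa> \<omega> i))) \<partial>M) =
    (\<Prod>i<n. \<Sum>k. ?c * ?p ^ k * (\<integral>\<^sup>+x. G i (walk_min x k) * H i (walk x k - walk_min x k) \<partial>\<xi>.S))"
    unfolding b_def \<kappa>_def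
  proof (rule nn_integral_grid_blocks[OF h, of "\<lambda>i k x. G i (walk_min x k) * H i (walk x k - walk_min x k)"])
    fix i k and x y :: "nat \<Rightarrow> real" assume xy: "\<And>j. j < k \<Longrightarrow> x j = y j"
    have "walk_min x k = walk_min y k" using xy by (rule min_eq)
    moreover have "walk x k = walk y k" using xy by (rule walk_eq) auto
    ultimately show "G i (walk_min x k) * H i (walk x k - walk_min x k) = G i (walk_min y k) * H i (walk y k - walk_min y k)"
      by simp
  qed measurable
  also have "\<dots> = (\<Prod>i<n. (\<integral>\<^sup>+\<omega>. G i (walk_min (b \<omega> 0) (\<kappa> \<omega> 0)) \<partial>M) * (\<integral>\<^sup>+\<omega>. H i (walk_max (b \<omega> 0) (\<kappa> \<omega> 0)) \<partial>M))"
    by (intro prod.cong refl) (simp only: 1 2 assms(2,3) \<xi>.Wiener_Hopf_geometric[OF q])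
  finally show ?thesis .
qed

end

section \<open>Drops and rises along the blocks\<close>

lemma block_sup_eq_inf: "block_sup t x i = - block_inf t (\<lambda>s. - x s) i"
  by (simp add: block_inf_def block_sup_def Inf_real_def image_image)

lemma block_inf_const_add:
  assumes t: "t 0 = 0" "strict_mono t" and x: "cadlag x"
  shows "block_inf t (\<lambda>s. v + x s) i = v + block_inf t x i"
proof (rule antisym)
  have ne: "{t i..t (Suc i)} \<noteq> {}" using t(2) by (auto simp: strict_mono_Suc_iff less_imp_le)
  have bdd: "bdd_below (y ` {t i..t (Suc i)})" if "cadlag y" for y
    using cadlag_bounded_on[OF that epochs_nonneg[OF t]] by (rule bounded_imp_bdd_below)
  have "block_inf t (\<lambda>s. v + x s) i - v \<le> block_inf t x i"
    unfolding block_inf_def[of t x]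
  proof (rule cINF_greatest[OF ne])
    fix s assume "s \<in> {t i..t (Suc i)}"
    then have "block_inf t (\<lambda>s. v + x s) i \<le> v + x s"
      unfolding block_inf_def by (intro cINF_lower bdd cadlag_const_add x)
    then show "block_inf t (\<lambda>s. v + x s) i - v \<le> x s" by simp
  qed
  then show "block_inf t (\<lambda>s. v + x s) i \<le> v + block_inf t x i" by simp
  show "v + block_inf t x i \<le> block_inf t (\<lambda>s. v + x s) i"
    unfolding block_inf_def[of t "\<lambda>s. v + x s"]
  proof (rule cINF_greatest[OF ne])
    fix s assume "s \<in> {t i..t (Suc i)}"
    then have "block_inf t x i \<le> x s" unfolding block_inf_def by (intro cINF_lower bdd x)
    then show "v + block_inf t x i \<le> v + x s" by simp
  qed
qed

lemma block_sup_const_add: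
  assumes t: "t 0 = 0" "strict_mono t" and x: "cadlag x"
  shows "block_sup t (\<lambda>s. v + x s) i = v + block_sup t x i"
  using block_inf_const_add[OF t cadlag_uminus[OF x], of "- v" i] by (simp add: block_sup_eq_inf)

text \<open>
  The path observed alternately at the epochs and at its block infima: the even entries are the
  drops from the start of a block to its infimum, the odd entries are the rises from there to the end
  of the block. In \<open>sup_steps\<close> the suprema take the place of the infima.
\<close>

definition inf_steps :: "(nat \<Rightarrow> real) \<Rightarrow> (real \<Rightarrow> real) \<Rightarrow> nat \<Rightarrow> real" where
  "inf_steps t x j = (let i = j div 2 in
     if even j then block_inf t x i - x (t i) else x (t (Suc i)) - block_inf t x i)"

definition sup_steps :: "(nat \<Rightarrow> real) \<Rightarrow> (real \<Rightarrow> real) \<Rightarrow> nat \<Rightarrow> real" where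
  "sup_steps t x j = (let i = j div 2 in
     if even j then block_sup t x i - x (t i) else x (t (Suc i)) - block_sup t x i)"

lemma inf_steps_simps [simp]:
  "inf_steps t x (2 * i) = block_inf t x i - x (t i)"
  "inf_steps t x (Suc (2 * i)) = x (t (Suc i)) - block_inf t x i"
  by (simp_all add: inf_steps_def)

lemma sup_steps_eq_inf: "sup_steps t x j = - inf_steps t (\<lambda>s. - x s) j"
  by (simp add: sup_steps_def inf_steps_def block_sup_eq_inf Let_def)

lemma walk_inf_steps:
  "walk (inf_steps t x) (2 * i) = x (t i) - x (t 0)"
  "walk (inf_steps t x) (Suc (2 * i)) = block_inf t x i - x (t 0)"
proof -
  show *: "walk (inf_steps t x) (2 * i) = x (t i) - x (t 0)" for i
    by (induction i) (simp_all add: walk_def)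
  show "walk (inf_steps t x) (Suc (2 * i)) = block_inf t x i - x (t 0)"
    using *[of i] by (simp add: walk_def)
qed

lemma walk_sup_steps:
  "walk (sup_steps t x) (2 * i) = x (t i) - x (t 0)"
  "walk (sup_steps t x) (Suc (2 * i)) = block_sup t x i - x (t 0)"
proof -
  have "walk (sup_steps t x) k = - walk (inf_steps t (\<lambda>s. - x s)) k" for k
    by (simp add: walk_def sup_steps_eq_inf sum_negf)
  then show "walk (sup_steps t x) (2 * i) = x (t i) - x (t 0)"
    "walk (sup_steps t x) (Suc (2 * i)) = block_sup t x i - x (t 0)"
    by (simp_all add: walk_inf_steps block_sup_eq_inf)
qed

lemma prod_pairs: "(\<Prod>j<2 * n. f j) = (\<Prod>i<n. f (2 * i) * f (Suc (2 * i)))"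
  by (induction n) (simp_all add: mult.assoc)

context levy_poisson
begin

text \<open>
  Reflection exchanges infima and suprema, so the statements about \<open>sup_steps\<close> follow from those
  about \<open>inf_steps\<close>.
\<close>

lemma levy_poisson_uminus: "levy_poisson M (\<lambda>t \<omega>. - X t \<omega>) T lam"
proof
  show "levy_process M (\<lambda>t \<omega>. - X t \<omega>)"
    unfolding levy_process_def
  proof (intro conjI allI impI ballI)
    show "prob_space M" by (rule prob_space_axioms)
    show "(\<lambda>\<omega>. - X t \<omega>) \<in> borel_measurable M" if "0 \<le> t" for t
      using X_measurable[OF that] by simp
    show "AE \<omega> in M. - X 0 \<omega> = 0" using levy by (simp add: levy_process_def)
    show "cadlag (\<lambda>t. - X t \<omega>)" if "\<omega> \<in> space M" for \<omega>
      using X_cadlag[OF that] by (rule cadlag_uminus)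
  next
    fix n and t :: "nat \<Rightarrow> real" assume "0 \<le> t 0" "mono_on {..n} t"
    then have "indep_vars (\<lambda>_. borel) (\<lambda>i \<omega>. X (t (Suc i)) \<omega> - X (t i) \<omega>) {..<n}"
      using levy by (simp add: levy_process_def)
    then have "indep_vars (\<lambda>_. borel) (\<lambda>i \<omega>. - (X (t (Suc i)) \<omega> - X (t i) \<omega>)) {..<n}"
      by (rule indep_vars_compose2) simp
    then show "indep_vars (\<lambda>_. borel) (\<lambda>i \<omega>. - X (t (Suc i)) \<omega> - - X (t i) \<omega>) {..<n}" by simp
  next
    fix s h :: real assume sh: "0 \<le> s" "0 \<le> h"
    have [measurable]: "X (s + h) \<in> borel_measurable M" "X s \<in> borel_measurable M" "X h \<in> borel_measurable M"
      using sh by (auto intro: X_measurable)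
    have "distr M borel (\<lambda>\<omega>. - (X (s + h) \<omega> - X s \<omega>)) = distr (distr M borel (\<lambda>\<omega>. X (s + h) \<omega> - X s \<omega>)) borel uminus"
      by (subst distr_distr) (simp_all add: comp_def)
    also have "distr M borel (\<lambda>\<omega>. X (s + h) \<omega> - X s \<omega>) = distr M borel (X h)"
      using levy sh by (simp add: levy_process_def)
    also have "distr (distr M borel (X h)) borel uminus = distr M borel (\<lambda>\<omega>. - X h \<omega>)"
      by (subst distr_distr) (simp_all add: comp_def)
    finally show "distr M borel (\<lambda>\<omega>. - X (s + h) \<omega> - - X s \<omega>) = distr M borel (\<lambda>\<omega>. - X h \<omega>)" by simp
  qed
  show "indep_elements M path_space (path_of (\<lambda>t \<omega>. - X t \<omega>)) epoch_space (\<lambda>\<omega> i. T i \<omega>)"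
  proof -
    have "indep_elements M path_space (\<lambda>\<omega>. \<lambda>t\<in>{0..}. - path_of X \<omega> t) epoch_space (\<lambda>\<omega> i. T i \<omega>)"
      by (rule indep_elements_compose[OF indep_X_T]) measurable
    moreover have "(\<lambda>\<omega>. \<lambda>t\<in>{0..}. - path_of X \<omega> t) = path_of (\<lambda>t \<omega>. - X t \<omega>)"
      by (simp add: path_of_def fun_eq_iff restrict_def)
    ultimately show ?thesis by simp
  qed
qed (use lam epochs in auto)

abbreviation low :: "nat \<Rightarrow> 'w \<Rightarrow> real" where
  "low i \<omega> \<equiv> block_inf (\<lambda>i. T i \<omega>) (\<lambda>t. X t \<omega>) i"

abbreviation high :: "nat \<Rightarrow> 'w \<Rightarrow> real" where
  "high i \<omega> \<equiv> block_sup (\<lambda>i. T i \<omega>) (\<lambda>t. X t \<omega>) i"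

abbreviation mesh :: "nat \<Rightarrow> real" where
  "mesh n \<equiv> inverse (real (Suc n))"

abbreviation counts :: "nat \<Rightarrow> nat \<Rightarrow> 'w \<Rightarrow> nat" where
  "counts n i \<omega> \<equiv> grid_counts (mesh n) (\<lambda>i. T i \<omega>) i"

abbreviation block :: "nat \<Rightarrow> nat \<Rightarrow> 'w \<Rightarrow> nat \<Rightarrow> real" where
  "block n i \<omega> \<equiv> grid_block (mesh n) (\<lambda>i. T i \<omega>) (\<lambda>t. X t \<omega>) i"

lemma block_limits:
  assumes "\<omega> \<in> space M"
  shows "(\<lambda>n. walk_min (block n i \<omega>) (counts n i \<omega>)) \<longlonglongrightarrow> low i \<omega> - X (T i \<omega>) \<omega>"
    and "(\<lambda>n. walk_max (block n i \<omega>) (counts n i \<omega>)) \<longlonglongrightarrow> high i \<omega> - X (T i \<omega>) \<omega>"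
    and "(\<lambda>n. walk (block n i \<omega>) (counts n i \<omega>)) \<longlonglongrightarrow> X (T (Suc i) \<omega>) \<omega> - X (T i \<omega>) \<omega>"
  using walk_min_block_tendsto[of "\<lambda>i. T i \<omega>" mesh "\<lambda>t. X t \<omega>" i]
    walk_max_block_tendsto[of "\<lambda>i. T i \<omega>" mesh "\<lambda>t. X t \<omega>" i]
    walk_block_tendsto[of "\<lambda>i. T i \<omega>" mesh "\<lambda>t. X t \<omega>" i]
    T_0[OF assms] T_strict_mono[OF assms] X_cadlag[OF assms] LIMSEQ_inverse_real_of_nat
  by simp_all

lemma block_measurable [measurable]:
  "(\<lambda>\<omega>. walk_min (block n i \<omega>) (counts n i \<omega>)) \<in> borel_measurable M"
  "(\<lambda>\<omega>. walk_max (block n i \<omega>) (counts n i \<omega>)) \<in> borel_measurable M"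
  "(\<lambda>\<omega>. walk (block n i \<omega>) (counts n i \<omega>)) \<in> borel_measurable M"
  by (rule measurable_grid_functional[where \<psi>="\<lambda>k x. walk_min x k"]
      measurable_grid_functional[where \<psi>="\<lambda>k x. walk_max x k"]
      measurable_grid_functional[where \<psi>="\<lambda>k x. walk x k"]; simp add: X_measurable)+

lemma increments_measurable [measurable]:
  "(\<lambda>\<omega>. low i \<omega> - X (T i \<omega>) \<omega>) \<in> borel_measurable M"
  "(\<lambda>\<omega>. high i \<omega> - X (T i \<omega>) \<omega>) \<in> borel_measurable M"
  "(\<lambda>\<omega>. X (T (Suc i) \<omega>) \<omega> - X (T i \<omega>) \<omega>) \<in> borel_measurable M"
  by (rule borel_measurable_LIMSEQ_real[OF block_limits(1) block_measurable(1)]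
      borel_measurable_LIMSEQ_real[OF block_limits(2) block_measurable(2)]
      borel_measurable_LIMSEQ_real[OF block_limits(3) block_measurable(3)]; assumption)+

lemma X_T_measurable [measurable]: "(\<lambda>\<omega>. X (T i \<omega>) \<omega>) \<in> borel_measurable M"
proof (induction i)
  case 0
  have "X 0 \<in> borel_measurable M" by (simp add: X_measurable)
  then show ?case by (simp add: T_0 cong: measurable_cong)
next
  case (Suc i)
  have "(\<lambda>\<omega>. (X (T (Suc i) \<omega>) \<omega> - X (T i \<omega>) \<omega>) + X (T i \<omega>) \<omega>) \<in> borel_measurable M"
    using Suc by measurable
  then show ?case by simp
qed

lemma low_measurable [measurable]: "low i \<in> borel_measurable M"
  and high_measurable [measurable]: "high i \<in> borel_measurable M"
proof -
  have "(\<lambda>\<omega>. (low i \<omega> - X (T i \<omega>) \<omega>) + X (T i \<omega>) \<omega>) \<in> borel_measurable M"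
    "(\<lambda>\<omega>. (high i \<omega> - X (T i \<omega>) \<omega>) + X (T i \<omega>) \<omega>) \<in> borel_measurable M" by measurable
  then show "low i \<in> borel_measurable M" "high i \<in> borel_measurable M" by simp_all
qed

text \<open>
  The limit of the discrete factorization. The test functions are bounded and continuous and the grid
  quantities converge for every outcome, so dominated convergence applies on both sides.
\<close>

lemma block_factorization:
  fixes G :: "nat \<Rightarrow> real \<Rightarrow> real"
  assumes cont: "\<And>j. continuous_on UNIV (G j)" and G0: "\<And>j z. 0 \<le> G j z" and G1: "\<And>j z. G j z \<le> 1"
  shows "(\<integral>\<^sup>+\<omega>. (\<Prod>j<2 * n. ennreal (G j (inf_steps (\<lambda>i. T i \<omega>) (\<lambda>t. X t \<omega>) j))) \<partial>M) =
    (\<Prod>j<2 * n. \<integral>\<^sup>+\<omega>. ennreal (G j ((if even j then low 0 \<omega> else high 0 \<omega>) - X (T 0 \<omega>) \<omega>)) \<partial>M)"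
proof -
  have meas [measurable]: "(\<lambda>z. ennreal (G j z)) \<in> borel_measurable borel" for j
    by (intro measurable_compose[OF borel_measurable_continuous_onI[OF cont]]) simp
  have lim: "(\<lambda>m. G j (f m)) \<longlonglongrightarrow> G j l" if "f \<longlonglongrightarrow> l" for f l j
    using continuous_on_tendsto_compose[OF cont that] by simp
  let ?I = "\<lambda>m i \<omega>. ennreal (G (2 * i) (walk_min (block m i \<omega>) (counts m i \<omega>)))"
  let ?J = "\<lambda>m i \<omega>. ennreal (G (Suc (2 * i)) (walk (block m i \<omega>) (counts m i \<omega>) - walk_min (block m i \<omega>) (counts m i \<omega>)))"
  let ?I' = "\<lambda>i \<omega>. ennreal (G (2 * i) (low i \<omega> - X (T i \<omega>) \<omega>))"
  let ?J' = "\<lambda>i \<omega>. ennreal (G (Suc (2 * i)) (X (T (Suc i) \<omega>) \<omega> - low i \<omega>))"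
  have IJ: "?I m i \<omega> * ?J m i \<omega> \<le> 1" for m i \<omega>
    using G1 by (intro mult_le_one) auto
  have L1: "(\<lambda>m. \<integral>\<^sup>+\<omega>. (\<Prod>i<n. ?I m i \<omega> * ?J m i \<omega>) \<partial>M) \<longlonglongrightarrow> (\<integral>\<^sup>+\<omega>. (\<Prod>i<n. ?I' i \<omega> * ?J' i \<omega>) \<partial>M)"
  proof (rule nn_integral_dominated_convergence[where w="\<lambda>_. 1"])
    show "AE \<omega> in M. (\<Prod>i<n. ?I m i \<omega> * ?J m i \<omega>) \<le> 1" for m
      using IJ by (auto intro!: prod_le_1)
    show "AE \<omega> in M. (\<lambda>m. \<Prod>i<n. ?I m i \<omega> * ?J m i \<omega>) \<longlonglongrightarrow> (\<Prod>i<n. ?I' i \<omega> * ?J' i \<omega>)"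
    proof (rule AE_I2)
      fix \<omega> assume \<omega>: "\<omega> \<in> space M"
      have "(\<lambda>m. walk (block m i \<omega>) (counts m i \<omega>) - walk_min (block m i \<omega>) (counts m i \<omega>)) \<longlonglongrightarrow>
          (X (T (Suc i) \<omega>) \<omega> - X (T i \<omega>) \<omega>) - (low i \<omega> - X (T i \<omega>) \<omega>)" for i
        by (intro tendsto_diff block_limits \<omega>)
      then have lJ: "(\<lambda>m. walk (block m i \<omega>) (counts m i \<omega>) - walk_min (block m i \<omega>) (counts m i \<omega>)) \<longlonglongrightarrow>
          X (T (Suc i) \<omega>) \<omega> - low i \<omega>" for i by simp
      have "(\<lambda>m. \<Prod>i<n. G (2 * i) (walk_min (block m i \<omega>) (counts m i \<omega>)) *
            G (Suc (2 * i)) (walk (block m i \<omega>) (counts m i \<omega>) - walk_min (block m i \<omega>) (counts m i \<omega>)))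
          \<longlonglongrightarrow> (\<Prod>i<n. G (2 * i) (low i \<omega> - X (T i \<omega>) \<omega>) * G (Suc (2 * i)) (X (T (Suc i) \<omega>) \<omega> - low i \<omega>))"
        by (intro tendsto_prod tendsto_mult lim lJ block_limits \<omega>)
      then show "(\<lambda>m. \<Prod>i<n. ?I m i \<omega> * ?J m i \<omega>) \<longlonglongrightarrow> (\<Prod>i<n. ?I' i \<omega> * ?J' i \<omega>)"
        using G0 by (simp add: ennreal_mult[symmetric] prod_ennreal)
    qed
    show "(\<lambda>\<omega>. \<Prod>i<n. ?I m i \<omega> * ?J m i \<omega>) \<in> borel_measurable M" for m
      by (intro borel_measurable_prod_ennreal borel_measurable_times_ennreal measurable_compose[OF _ meas]) measurable
    show "(\<lambda>\<omega>. \<Prod>i<n. ?I' i \<omega> * ?J' i \<omega>) \<in> borel_measurable M"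
      by (intro borel_measurable_prod_ennreal borel_measurable_times_ennreal measurable_compose[OF _ meas]) measurable
  qed (auto simp: emeasure_space_1)
  let ?A = "\<lambda>m j. \<integral>\<^sup>+\<omega>. ennreal (G j (walk_min (block m 0 \<omega>) (counts m 0 \<omega>))) \<partial>M"
  let ?B = "\<lambda>m j. \<integral>\<^sup>+\<omega>. ennreal (G j (walk_max (block m 0 \<omega>) (counts m 0 \<omega>))) \<partial>M"
  let ?A' = "\<lambda>j. \<integral>\<^sup>+\<omega>. ennreal (G j (low 0 \<omega> - X (T 0 \<omega>) \<omega>)) \<partial>M"
  let ?B' = "\<lambda>j. \<integral>\<^sup>+\<omega>. ennreal (G j (high 0 \<omega> - X (T 0 \<omega>) \<omega>)) \<partial>M"
  have LA: "(\<lambda>m. ?A m j) \<longlonglongrightarrow> ?A' j" for j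
    by (rule nn_integral_dominated_convergence[where w="\<lambda>_. 1"])
      (auto intro!: tendsto_ennrealI lim block_limits G1 measurable_compose[OF _ meas] simp: emeasure_space_1 simp del: of_nat_Suc)
  have LB: "(\<lambda>m. ?B m j) \<longlonglongrightarrow> ?B' j" for j
    by (rule nn_integral_dominated_convergence[where w="\<lambda>_. 1"])
      (auto intro!: tendsto_ennrealI lim block_limits G1 measurable_compose[OF _ meas] simp: emeasure_space_1 simp del: of_nat_Suc)
  have fin: "(\<integral>\<^sup>+\<omega>. ennreal (G j (f \<omega>)) \<partial>M) \<noteq> \<top>" for j f
  proof -
    have "(\<integral>\<^sup>+\<omega>. ennreal (G j (f \<omega>)) \<partial>M) \<le> (\<integral>\<^sup>+\<omega>. 1 \<partial>M)"
      by (intro nn_integral_mono) (auto intro: G1)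
    then show ?thesis by (auto simp: emeasure_space_1 top_unique)
  qed
  have "(\<lambda>m. \<Prod>i<k. ?A m (2 * i) * ?B m (Suc (2 * i))) \<longlonglongrightarrow> (\<Prod>i<k. ?A' (2 * i) * ?B' (Suc (2 * i)))" for k
  proof (induction k)
    case (Suc k)
    have "(\<Prod>i<k. ?A' (2 * i) * ?B' (Suc (2 * i))) \<noteq> \<top>" "?A' (2 * k) * ?B' (Suc (2 * k)) \<noteq> \<top>"
      using fin by (simp_all add: ennreal_prod_eq_top ennreal_mult_eq_top_iff)
    then show ?case
      unfolding prod.lessThan_Suc
      by (intro tendsto_mult_ennreal Suc LA LB) (use fin in auto)
  qed simp
  moreover have "(\<integral>\<^sup>+\<omega>. (\<Prod>i<n. ?I m i \<omega> * ?J m i \<omega>) \<partial>M) = (\<Prod>i<n. ?A m (2 * i) * ?B m (Suc (2 * i)))" for m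
    by (rule grid_factorization) simp_all
  ultimately have "(\<integral>\<^sup>+\<omega>. (\<Prod>i<n. ?I' i \<omega> * ?J' i \<omega>) \<partial>M) = (\<Prod>i<n. ?A' (2 * i) * ?B' (Suc (2 * i)))"
    using L1 by (metis (no_types, lifting) LIMSEQ_unique ext)
  then show ?thesis by (simp add: prod_pairs)
qed

end

section \<open>The passage identities\<close>

lemma exists_neg_iff_rational:
  assumes x: "cadlag x"
  shows "(\<exists>t\<ge>0. x t < 0) \<longleftrightarrow> (\<exists>q::rat. 0 \<le> (of_rat q :: real) \<and> x (of_rat q) < 0)"
proof
  assume "\<exists>t\<ge>0. x t < 0"
  then obtain t where t: "0 \<le> t" "x t < 0" by blast
  have "(x \<longlongrightarrow> x t) (at_right t)"
    using x t by (auto simp: cadlag_def continuous_within)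
  then have "\<forall>\<^sub>F s in at_right t. x s < 0" using t(2) by (rule order_tendstoD)
  then obtain c where c: "t < c" "\<And>s. t < s \<Longrightarrow> s < c \<Longrightarrow> x s < 0"
    by (auto simp: eventually_at_right_field)
  obtain q where "t < of_rat q" "of_rat q < c" using of_rat_dense[OF c(1)] by blast
  then have "x (of_rat q) < 0" by (rule c(2))
  moreover have "0 \<le> (of_rat q :: real)" using t(1) \<open>t < of_rat q\<close> by linarith
  ultimately show "\<exists>q::rat. 0 \<le> (of_rat q :: real) \<and> x (of_rat q) < 0" by blast
qed blast

context levy_poisson
begin

text \<open>
  Subtracting the initial value keeps the identities valid for every outcome: \<open>X 0 = 0\<close> is only
  assumed almost surely.
\<close>

abbreviation low_law :: "real measure" where
  "low_law \<equiv> distr M borel (\<lambda>\<omega>. low 0 \<omega> - X (T 0 \<omega>) \<omega>)"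

abbreviation high_law :: "real measure" where
  "high_law \<equiv> distr M borel (\<lambda>\<omega>. high 0 \<omega> - X (T 0 \<omega>) \<omega>)"

abbreviation low_steps :: "'w \<Rightarrow> nat \<Rightarrow> real" where
  "low_steps \<omega> \<equiv> inf_steps (\<lambda>i. T i \<omega>) (\<lambda>t. X t \<omega>)"

abbreviation high_steps :: "'w \<Rightarrow> nat \<Rightarrow> real" where
  "high_steps \<omega> \<equiv> sup_steps (\<lambda>i. T i \<omega>) (\<lambda>t. X t \<omega>)"

lemma steps_measurable [measurable]:
  "(\<lambda>\<omega>. low_steps \<omega> j) \<in> borel_measurable M"
  "(\<lambda>\<omega>. high_steps \<omega> j) \<in> borel_measurable M"
  unfolding inf_steps_def sup_steps_def Let_def by (cases "even j"; simp)+

text \<open>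
  The central fact, and a form of the Wiener-Hopf factorization: along the blocks the drops and rises
  are all independent, the drops are distributed like the infimum over the first period, and the
  rises like the supremum.
\<close>

lemma distr_low_steps: "distr M (PiM UNIV (\<lambda>_. borel)) low_steps = alt_law low_law high_law"
proof -
  have "distr M (PiM UNIV (\<lambda>_. borel)) (\<lambda>\<omega> j. low_steps \<omega> j) =
      PiM UNIV (\<lambda>j. distr M borel (\<lambda>\<omega>. (if even j then low 0 \<omega> else high 0 \<omega>) - X (T 0 \<omega>) \<omega>))"
    by (rule distr_eq_PiM_continuous) (use block_factorization in auto)
  also have "\<dots> = alt_law low_law high_law"
    unfolding alt_law_def by (intro arg_cong[where f="PiM UNIV"] ext) simp
  finally show ?thesis by simp
qed

text \<open>
  The same alternating walk with the two laws interchanged, by reflection.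
\<close>

lemma distr_high_steps: "distr M (PiM UNIV (\<lambda>_. borel)) high_steps = alt_law high_law low_law"
proof -
  interpret neg: levy_poisson M "\<lambda>t \<omega>. - X t \<omega>" T lam by (rule levy_poisson_uminus)
  have "distr M (PiM UNIV (\<lambda>_. borel)) (\<lambda>\<omega> j. high_steps \<omega> j) =
      PiM UNIV (\<lambda>j. distr M borel (\<lambda>\<omega>. (if even j then high 0 \<omega> else low 0 \<omega>) - X (T 0 \<omega>) \<omega>))"
  proof (rule distr_eq_PiM_continuous)
    fix n and G :: "nat \<Rightarrow> real \<Rightarrow> real"
    assume G: "\<And>j. continuous_on UNIV (G j)" "\<And>j z. 0 \<le> G j z" "\<And>j z. G j z \<le> 1"
    have "continuous_on UNIV (\<lambda>z. G j (- z))" for j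
      by (rule continuous_on_compose2[OF G(1)]) (auto intro: continuous_intros)
    from neg.block_factorization[of "\<lambda>j z. G j (- z)", OF this G(2,3)]
    have "(\<integral>\<^sup>+\<omega>. (\<Prod>j<2 * n. ennreal (G j (high_steps \<omega> j))) \<partial>M) =
      (\<Prod>j<2 * n. \<integral>\<^sup>+\<omega>. ennreal (G j (- ((if even j then neg.low 0 \<omega> else neg.high 0 \<omega>) - (- X (T 0 \<omega>) \<omega>)))) \<partial>M)"
      by (simp add: sup_steps_eq_inf)
    also have "\<dots> = (\<Prod>j<2 * n. \<integral>\<^sup>+\<omega>. ennreal (G j ((if even j then high 0 \<omega> else low 0 \<omega>) - X (T 0 \<omega>) \<omega>)) \<partial>M)"
      by (intro prod.cong refl nn_integral_cong) (simp add: block_sup_eq_inf)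
    finally show "(\<integral>\<^sup>+\<omega>. (\<Prod>j<2 * n. ennreal (G j (high_steps \<omega> j))) \<partial>M) =
      (\<Prod>j<2 * n. \<integral>\<^sup>+\<omega>. ennreal (G j ((if even j then high 0 \<omega> else low 0 \<omega>) - X (T 0 \<omega>) \<omega>)) \<partial>M)" .
  qed auto
  also have "\<dots> = alt_law high_law low_law"
    unfolding alt_law_def by (intro arg_cong[where f="PiM UNIV"] ext) simp
  finally show ?thesis by simp
qed

lemma X_T_0_AE: "AE \<omega> in M. X (T 0 \<omega>) \<omega> = 0"
proof -
  have "AE \<omega> in M. X 0 \<omega> = 0" using levy by (simp add: levy_process_def)
  then show ?thesis using AE_space by eventually_elim (simp add: T_0)
qed

lemma low_law_eq: "low_law = distr M borel (\<lambda>\<omega>. running_inf (\<lambda>t. X t \<omega>) (T 1 \<omega>))"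
proof (rule distr_cong_AE)
  have eq: "low 0 \<omega> = running_inf (\<lambda>t. X t \<omega>) (T 1 \<omega>)" if "\<omega> \<in> space M" for \<omega>
    using T_0[OF that] by (simp add: block_inf_def running_inf_def)
  show "AE \<omega> in M. low 0 \<omega> - X (T 0 \<omega>) \<omega> = running_inf (\<lambda>t. X t \<omega>) (T 1 \<omega>)"
    using X_T_0_AE AE_space by eventually_elim (simp add: eq)
  show "(\<lambda>\<omega>. running_inf (\<lambda>t. X t \<omega>) (T 1 \<omega>)) \<in> borel_measurable M"
    by (rule iffD1[OF measurable_cong low_measurable[of 0]]) (rule eq)
qed simp_all

lemma high_law_eq: "high_law = distr M borel (\<lambda>\<omega>. running_sup (\<lambda>t. X t \<omega>) (T 1 \<omega>))"
proof (rule distr_cong_AE)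
  have eq: "high 0 \<omega> = running_sup (\<lambda>t. X t \<omega>) (T 1 \<omega>)" if "\<omega> \<in> space M" for \<omega>
    using T_0[OF that] by (simp add: block_sup_def running_sup_def)
  show "AE \<omega> in M. high 0 \<omega> - X (T 0 \<omega>) \<omega> = running_sup (\<lambda>t. X t \<omega>) (T 1 \<omega>)"
    using X_T_0_AE AE_space by eventually_elim (simp add: eq)
  show "(\<lambda>\<omega>. running_sup (\<lambda>t. X t \<omega>) (T 1 \<omega>)) \<in> borel_measurable M"
    by (rule iffD1[OF measurable_cong high_measurable[of 0]]) (rule eq)
qed simp_all

lemma prob_falls_first:
  assumes law: "distr M (PiM UNIV (\<lambda>_. borel)) S = alt_law \<alpha> \<beta>"
    and S: "\<And>j. (\<lambda>\<omega>. S \<omega> j) \<in> borel_measurable M"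
    and w [measurable]: "\<And>i. (\<lambda>\<omega>. w \<omega> i) \<in> borel_measurable M"
    and eq: "AE \<omega> in M. \<forall>i. w \<omega> i = v + walk (S \<omega>) (2 * i + c)"
  shows "prob {\<omega> \<in> space M. falls_first a (w \<omega>)} = alt_falls a \<alpha> \<beta> c v"
proof -
  have S [measurable]: "S \<in> measurable M (PiM UNIV (\<lambda>_. borel))"
    using measurable_abs_UNIV[of "\<lambda>j \<omega>. S \<omega> j", OF S] by simp
  have "{z \<in> space (PiM UNIV (\<lambda>_. borel)). falls_first a (\<lambda>i. v + walk z (2 * i + c))} \<in> sets (PiM UNIV (\<lambda>_. borel))"
    by measurable
  then have sets: "{z. falls_first a (\<lambda>i. v + walk z (2 * i + c))} \<in> sets (PiM UNIV (\<lambda>_. borel))"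
    by (simp add: space_PiM)
  have "prob {\<omega> \<in> space M. falls_first a (w \<omega>)} = prob {\<omega> \<in> space M. falls_first a (\<lambda>i. v + walk (S \<omega>) (2 * i + c))}"
  proof (rule finite_measure_eq_AE)
    show "AE \<omega> in M. (\<omega> \<in> {\<omega> \<in> space M. falls_first a (w \<omega>)}) = (\<omega> \<in> {\<omega> \<in> space M. falls_first a (\<lambda>i. v + walk (S \<omega>) (2 * i + c))})"
      using eq by eventually_elim (simp add: falls_first_def)
  qed measurable
  also have "\<dots> = measure (distr M (PiM UNIV (\<lambda>_. borel)) S) {z. falls_first a (\<lambda>i. v + walk z (2 * i + c))}"
    using sets by (simp add: measure_distr vimage_def Int_def conj_commute)
  finally show ?thesis by (simp add: law alt_falls_def)
qed

text \<open>
  The positions at the epochs are the even times of both alternating walks, which gives two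
  expressions for the same probability.
\<close>

lemma prob_from_tau_hat:
  assumes a: "0 \<le> a"
  shows "prob_from M X T v (\<lambda>T x. tau_hat_below 0 T x < tau_hat_above a T x) = alt_falls a low_law high_law 0 v"
    and "prob_from M X T v (\<lambda>T x. tau_hat_below 0 T x < tau_hat_above a T x) = alt_falls a high_law low_law 0 v"
proof -
  have ev: "prob_from M X T v (\<lambda>T x. tau_hat_below 0 T x < tau_hat_above a T x) =
      prob {\<omega> \<in> space M. falls_first a (\<lambda>i. v + X (T i \<omega>) \<omega>)}"
    unfolding prob_from_def
    by (intro arg_cong[where f=prob] Collect_cong conj_cong refl tau_hat_less_iff T_strict_mono a)
  have "AE \<omega> in M. \<forall>i. v + X (T i \<omega>) \<omega> = v + walk (low_steps \<omega>) (2 * i + 0)"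
    using X_T_0_AE by eventually_elim (simp add: walk_inf_steps)
  then show "prob_from M X T v (\<lambda>T x. tau_hat_below 0 T x < tau_hat_above a T x) = alt_falls a low_law high_law 0 v"
    unfolding ev by (intro prob_falls_first[OF distr_low_steps]) measurable
  have "AE \<omega> in M. \<forall>i. v + X (T i \<omega>) \<omega> = v + walk (high_steps \<omega>) (2 * i + 0)"
    using X_T_0_AE by eventually_elim (simp add: walk_sup_steps)
  then show "prob_from M X T v (\<lambda>T x. tau_hat_below 0 T x < tau_hat_above a T x) = alt_falls a high_law low_law 0 v"
    unfolding ev by (intro prob_falls_first[OF distr_high_steps]) measurable
qed

lemma prob_from_tau_tilde_below:
  assumes a: "0 \<le> a"
  shows "prob_from M X T v (\<lambda>T x. tau_tilde_below 0 T x < tau_above a x) = alt_falls a high_law low_law 1 v"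
proof -
  have "(tau_tilde_below 0 (\<lambda>i. T i \<omega>) (\<lambda>t. v + X t \<omega>) < tau_above a (\<lambda>t. v + X t \<omega>)) =
      falls_first a (\<lambda>i. v + high i \<omega>)" if "\<omega> \<in> space M" for \<omega>
    using tau_tilde_below_less_above_iff[OF T_0[OF that] T_strict_mono[OF that] cadlag_const_add[OF X_cadlag[OF that]] a]
      ext[of "block_sup (\<lambda>i. T i \<omega>) (\<lambda>t. v + X t \<omega>)", OF block_sup_const_add[OF T_0[OF that] T_strict_mono[OF that] X_cadlag[OF that]]]
    by simp
  then have ev: "prob_from M X T v (\<lambda>T x. tau_tilde_below 0 T x < tau_above a x) =
      prob {\<omega> \<in> space M. falls_first a (\<lambda>i. v + high i \<omega>)}"
    unfolding prob_from_def by (intro arg_cong[where f=prob] Collect_cong conj_cong refl)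
  have "AE \<omega> in M. \<forall>i. v + high i \<omega> = v + walk (high_steps \<omega>) (2 * i + 1)"
    using X_T_0_AE by eventually_elim (simp add: walk_sup_steps)
  then show ?thesis
    unfolding ev by (intro prob_falls_first[OF distr_high_steps]) measurable
qed

lemma prob_from_tau_tilde_above:
  assumes a: "0 \<le> a"
  shows "prob_from M X T v (\<lambda>T x. tau_below 0 x < tau_tilde_above a T x) = alt_falls a low_law high_law 1 v"
proof -
  \<comment> \<open>the path becomes negative; rational times suffice and make the event measurable\<close>
  define R where "R \<omega> \<longleftrightarrow> (\<exists>q::rat. 0 \<le> (of_rat q :: real) \<and> v + X (of_rat q) \<omega> < 0)" for \<omega>
  have R: "R \<omega> \<longleftrightarrow> (\<exists>t\<ge>0. v + X t \<omega> < 0)" if "\<omega> \<in> space M" for \<omega>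
    unfolding R_def using exists_neg_iff_rational[OF cadlag_const_add[OF X_cadlag[OF that]], of v] by simp
  have [measurable]: "Measurable.pred M R"
    unfolding R_def
  proof (rule pred_intros_countable)
    fix q :: rat
    show "Measurable.pred M (\<lambda>\<omega>. 0 \<le> (of_rat q :: real) \<and> v + X (of_rat q) \<omega> < 0)"
    proof (cases "0 \<le> (of_rat q :: real)")
      case True
      then have [measurable]: "X (of_rat q) \<in> borel_measurable M" by (rule X_measurable)
      show ?thesis by measurable
    qed simp
  qed
  have iff: "(tau_below 0 (\<lambda>t. v + X t \<omega>) < tau_tilde_above a (\<lambda>i. T i \<omega>) (\<lambda>t. v + X t \<omega>)) =
      (falls_first a (\<lambda>i. v + low i \<omega>) \<or> R \<omega> \<and> (\<forall>i. v + low i \<omega> \<le> a))" if "\<omega> \<in> space M" for \<omega>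
    using tau_below_less_tilde_above_iff[OF T_0[OF that] T_strict_mono[OF that] cadlag_const_add[OF X_cadlag[OF that]] a]
      ext[of "block_inf (\<lambda>i. T i \<omega>) (\<lambda>t. v + X t \<omega>)", OF block_inf_const_add[OF T_0[OF that] T_strict_mono[OF that] X_cadlag[OF that]]] R[OF that]
    by simp
  then have ev: "prob_from M X T v (\<lambda>T x. tau_below 0 x < tau_tilde_above a T x) =
      prob {\<omega> \<in> space M. falls_first a (\<lambda>i. v + low i \<omega>) \<or> R \<omega> \<and> (\<forall>i. v + low i \<omega> \<le> a)}"
    unfolding prob_from_def by (intro arg_cong[where f=prob] Collect_cong conj_cong refl)
  have "prob {\<omega> \<in> space M. falls_first a (\<lambda>i. v + low i \<omega>) \<or> R \<omega> \<and> (\<forall>i. v + low i \<omega> \<le> a)} =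
      prob {\<omega> \<in> space M. falls_first a (\<lambda>i. v + low i \<omega>)}"
  proof (rule finite_measure_eq_AE)
    show "AE \<omega> in M. (\<omega> \<in> {\<omega> \<in> space M. falls_first a (\<lambda>i. v + low i \<omega>) \<or> R \<omega> \<and> (\<forall>i. v + low i \<omega> \<le> a)}) =
        (\<omega> \<in> {\<omega> \<in> space M. falls_first a (\<lambda>i. v + low i \<omega>)})"
      using T_unbounded AE_space
    proof eventually_elim
      case (elim \<omega>)
      have "falls_first a (\<lambda>i. v + low i \<omega>)" if neg: "R \<omega>" and le: "\<forall>i. v + low i \<omega> \<le> a"
      proof -
        obtain t where t: "0 \<le> t" "v + X t \<omega> < 0" using iffD1[OF R[OF elim(2)] neg] by auto
        obtain n where n: "t < T n \<omega>" using elim(1) by blast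
        obtain i where i: "T i \<omega> \<le> t" "t < T (Suc i) \<omega>"
          using epoch_block[of "\<lambda>i. T i \<omega>", OF T_0[OF elim(2)] t(1) n] by auto
        have "low i \<omega> \<le> X t \<omega>"
          unfolding block_inf_def
        proof (rule cINF_lower)
          show "bdd_below ((\<lambda>t. X t \<omega>) ` {T i \<omega>..T (Suc i) \<omega>})"
            using cadlag_bounded_on[OF X_cadlag[OF elim(2)]
                epochs_nonneg[of "\<lambda>i. T i \<omega>", OF T_0[OF elim(2)] T_strict_mono[OF elim(2)]]]
            by (rule bounded_imp_bdd_below)
        qed (use i in auto)
        then show ?thesis using t le by (auto simp: falls_first_def intro!: exI[of _ i])
      qed
      then show ?case by blast
    qed
  qed measurable
  also have "\<dots> = alt_falls a low_law high_law 1 v"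
  proof (rule prob_falls_first[OF distr_low_steps])
    show "AE \<omega> in M. \<forall>i. v + low i \<omega> = v + walk (low_steps \<omega>) (2 * i + 1)"
      using X_T_0_AE by eventually_elim (simp add: walk_inf_steps)
  qed measurable
  finally show ?thesis unfolding ev .
qed

lemma prob_space_low_law: "prob_space low_law" and prob_space_high_law: "prob_space high_law"
  by (intro prob_space_distr; simp)+

end

theorem mainTheorem6:
  fixes M :: "'w measure" and X :: "real \<Rightarrow> 'w \<Rightarrow> real" and T :: "nat \<Rightarrow> 'w \<Rightarrow> real"
    and D U :: "'w \<Rightarrow> real" and lam a u :: real
  assumes levy: "levy_process M X"
    and lam: "lam > 0"
    and epochs: "poisson_epochs M lam T"
    and indep_X_T: "indep_elements M path_space (path_of X) epoch_space (\<lambda>\<omega> i. T i \<omega>)"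
    and law_D: "distr M borel D = distr M borel (\<lambda>\<omega>. running_inf (\<lambda>t. X t \<omega>) (T 1 \<omega>))"
    and law_U: "distr M borel U = distr M borel (\<lambda>\<omega>. running_sup (\<lambda>t. X t \<omega>) (T 1 \<omega>))"
    and indep_D_U: "prob_space.indep_var M borel D borel U"
    and indep_rest: "indep_elements M
        (path_space \<Otimes>\<^sub>M epoch_space) (\<lambda>\<omega>. (path_of X \<omega>, \<lambda>i. T i \<omega>))
        (borel \<Otimes>\<^sub>M borel) (\<lambda>\<omega>. (D \<omega>, U \<omega>))"
    and u: "u \<in> {0..a}"
  shows "prob_from M X T u (\<lambda>T x. tau_hat_below 0 T x < tau_hat_above a T x)
       = (\<integral>\<omega>. prob_from M X T (u + U \<omega>) (\<lambda>T x. tau_below 0 x < tau_tilde_above a T x) \<partial>M)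
    \<and> prob_from M X T u (\<lambda>T x. tau_hat_below 0 T x < tau_hat_above a T x)
       = (\<integral>\<omega>. prob_from M X T (u + D \<omega>) (\<lambda>T x. tau_tilde_below 0 T x < tau_above a x) \<partial>M)
    \<and> prob_from M X T u (\<lambda>T x. tau_below 0 x < tau_tilde_above a T x)
       = (\<integral>\<omega>. prob_from M X T (u + D \<omega>) (\<lambda>T x. tau_hat_below 0 T x < tau_hat_above a T x) \<partial>M)
    \<and> prob_from M X T u (\<lambda>T x. tau_tilde_below 0 T x < tau_above a x)
       = (\<integral>\<omega>. prob_from M X T (u + U \<omega>) (\<lambda>T x. tau_hat_below 0 T x < tau_hat_above a T x) \<partial>M)"
proof -
  interpret prob_space M using levy by (simp add: levy_process_def)
  interpret levy_poisson M X T lam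
    by unfold_locales (fact levy lam epochs indep_X_T)+
  have a: "0 \<le> a" using u by simp
  have D [measurable]: "D \<in> borel_measurable M" and U [measurable]: "U \<in> borel_measurable M"
    using indep_var_rv1[OF indep_D_U] indep_var_rv2[OF indep_D_U] by simp_all
  have \<delta>: "low_law = distr M borel D" and \<upsilon>: "high_law = distr M borel U"
    by (simp_all only: low_law_eq high_law_eq law_D law_U)
  note low = prob_space_low_law sets_distr[of M borel "\<lambda>\<omega>. low 0 \<omega> - X (T 0 \<omega>) \<omega>"]
  note high = prob_space_high_law sets_distr[of M borel "\<lambda>\<omega>. high 0 \<omega> - X (T 0 \<omega>) \<omega>"]
  have via_D: "alt_falls a low_law high_law (Suc c) u = (\<integral>\<omega>. alt_falls a high_law low_law c (u + D \<omega>) \<partial>M)" for c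
    using alt_falls_Suc(2)[OF low high, of a c u] integral_distr[OF D measurable_alt_falls[OF low high, of a c u]]
    by (simp add: \<delta>)
  have via_U: "alt_falls a high_law low_law (Suc c) u = (\<integral>\<omega>. alt_falls a low_law high_law c (u + U \<omega>) \<partial>M)" for c
    using alt_falls_Suc(2)[OF high low, of a c u] integral_distr[OF U measurable_alt_falls[OF high low, of a c u]]
    by (simp add: \<upsilon>)
  note tilde = prob_from_tau_tilde_above[OF a] prob_from_tau_tilde_below[OF a]
  show ?thesis
  proof (intro conjI)
    show "prob_from M X T u (\<lambda>T x. tau_hat_below 0 T x < tau_hat_above a T x)
       = (\<integral>\<omega>. prob_from M X T (u + U \<omega>) (\<lambda>T x. tau_below 0 x < tau_tilde_above a T x) \<partial>M)"
      using via_U[of 1] by (simp add: tilde prob_from_tau_hat(2)[OF a] alt_falls_0_eq_2[OF u] numeral_2_eq_2)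
    show "prob_from M X T u (\<lambda>T x. tau_hat_below 0 T x < tau_hat_above a T x)
       = (\<integral>\<omega>. prob_from M X T (u + D \<omega>) (\<lambda>T x. tau_tilde_below 0 T x < tau_above a x) \<partial>M)"
      using via_D[of 1] by (simp add: tilde prob_from_tau_hat(1)[OF a] alt_falls_0_eq_2[OF u] numeral_2_eq_2)
    show "prob_from M X T u (\<lambda>T x. tau_below 0 x < tau_tilde_above a T x)
       = (\<integral>\<omega>. prob_from M X T (u + D \<omega>) (\<lambda>T x. tau_hat_below 0 T x < tau_hat_above a T x) \<partial>M)"
      using via_D[of 0] by (simp add: tilde prob_from_tau_hat(2)[OF a])
    show "prob_from M X T u (\<lambda>T x. tau_tilde_below 0 T x < tau_above a x)
       = (\<integral>\<omega>. prob_from M X T (u + U \<omega>) (\<lambda>T x. tau_hat_below 0 T x < tau_hat_above a T x) \<partial>M)"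
      using via_U[of 0] by (simp add: tilde prob_from_tau_hat(1)[OF a])
  qed
qed

end
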